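(* Let $\Omega$ be a domain in $\mathbb C$. Let $X$ be a compact complex space with a hermitian metric $E$, let $S$ be a complex hypersurface in $X$, and let $M=X\setminus S$. Let $\mathcal F\subset\mathrm{Hol}(\Omega,M)$. Then $\mathcal F$ is not normal (as a subset of $\mathrm{Hol}(\Omega,M)$) if and only if there exist sequences $\{p_j\}\subset\Omega$ with $p_j\to p_0\in\Omega$ as $j\to\infty$, $\{f_j\}\subset\mathcal F$, and $\{\rho_j\}\subset\mathbb R$ with $\rho_j>0$ and $\rho_j\to0^+$ as $j\to\infty$, such that the sequence $$g_j(\xi):=f_j(p_j+\rho_j\xi),\quad \xi\in\mathbb C,$$ satisfies one of the following two assertions: (i) the sequence $\{g_j\}$ is compactly divergent on $\mathbb C$ (as a sequence of maps into $M$); (ii) the sequence $\{g_j\}$ converges uniformly on compact subsets of $\mathbb C$ to a non-constant $E$-Brody curve $g:\mathbb C\to M$.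
   Context: $\mathrm{Hol}(X,Y)$ is the set of holomorphic maps $X\to Y$. A complex hypersurface $S$ of a complex space $X$ is a closed analytic subset such that every point of $S$ has an open neighborhood $U$ in $X$ and a holomorphic function $f:U\to\mathbb C$ with $U\cap S=\{w\in U: f(w)=0\}$. A holomorphic curve $g:\mathbb C\to M$ is an $E$-Brody curve if the $E$-length $|g'(z)|_E$ of its derivative is bounded on $\mathbb C$. A family $\mathcal F\subset\mathrm{Hol}(X,Y)$ is normal if it is relatively compact in $\mathrm{Hol}(X,Y)$ in the compact-open topology (so limits must have values in $Y$). A sequence $\{f_j\}$ of holomorphic maps from $X$ to $Y$ is compactly divergent if for all compact sets $K\subset X$ and $L\subset Y$ there is $j_0$ with $f_j(K)\cap L=\emptyset$ for all $j\ge j_0$. Each $g_j$ is defined only where $p_j+\rho_j\xi\in\Omega$; any given compact subset of $\mathbb C$ lies in its domain for all large $j$, and compact divergence and uniform convergence on compact subsets of $\mathbb C$ are understood accordingly. *)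

theory Defs
  imports "HOL-Complex_Analysis.Complex_Analysis"
begin

section \<open>Several complex variables\<close>

text \<open>Complex differentiability at every point of an open subset of \<open>\<complex>\<^sup>n\<close>: the real
  Frechet derivative exists and is complex linear.\<close>

definition holo_on :: "(complex^'n::finite \<Rightarrow> complex) \<Rightarrow> (complex^'n) set \<Rightarrow> bool" where
  "holo_on f D \<longleftrightarrow> open D \<and>
     (\<forall>z\<in>D. \<exists>f'. (f has_derivative f') (at z) \<and> (\<forall>a v. f' (a *s v) = a * f' v))"

definition holo_map_on ::
  "(complex^'n::finite \<Rightarrow> complex^'m::finite) \<Rightarrow> (complex^'n) set \<Rightarrow> bool" where
  "holo_map_on f D \<longleftrightarrow> (\<forall>i. holo_on (\<lambda>z. f z $ i) D)"

text \<open>Smoothness in the real sense.\<close>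

primrec Ck_on :: "nat \<Rightarrow> (complex^'n::finite \<Rightarrow> complex) \<Rightarrow> (complex^'n) set \<Rightarrow> bool" where
  "Ck_on 0 f D \<longleftrightarrow> continuous_on D f"
| "Ck_on (Suc k) f D \<longleftrightarrow> (\<forall>z\<in>D. f differentiable (at z)) \<and>
     (\<forall>v. Ck_on k (\<lambda>z. frechet_derivative f (at z) v) D)"

definition smooth_on :: "(complex^'n::finite \<Rightarrow> complex) \<Rightarrow> (complex^'n) set \<Rightarrow> bool" where
  "smooth_on f D \<longleftrightarrow> open D \<and> (\<forall>k. Ck_on k f D)"

definition analytic_subset :: "(complex^'n::finite) set \<Rightarrow> (complex^'n) set \<Rightarrow> bool" where
  "analytic_subset D A \<longleftrightarrow> open D \<and> A \<subseteq> D \<and>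
     (\<forall>z\<in>D. \<exists>U Fs. open U \<and> z \<in> U \<and> U \<subseteq> D \<and> finite Fs \<and> (\<forall>f\<in>Fs. holo_on f U) \<and>
        U \<inter> A = {w\<in>U. \<forall>f\<in>Fs. f w = 0})"

text \<open>Holomorphy on a subset \<open>B\<close> (in practice a relatively open part of an analytic subset):
  locally the restriction of a holomorphic function of the ambient space.\<close>

definition sub_holo :: "(complex^'n::finite) set \<Rightarrow> (complex^'n \<Rightarrow> complex) \<Rightarrow> bool" where
  "sub_holo B h \<longleftrightarrow>
     (\<forall>z\<in>B. \<exists>U g. open U \<and> z \<in> U \<and> holo_on g U \<and> (\<forall>w\<in>U \<inter> B. g w = h w))"

text \<open>The Zariski tangent space of \<open>A\<close> at \<open>z\<close>.\<close>

definition zariski_tangent ::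
  "(complex^'n::finite) set \<Rightarrow> complex^'n \<Rightarrow> (complex^'n) set" where
  "zariski_tangent A z = {v. \<forall>U f. z \<in> U \<longrightarrow> holo_on f U \<longrightarrow> (\<forall>w\<in>U \<inter> A. f w = 0)
      \<longrightarrow> frechet_derivative f (at z) v = 0}"


section \<open>Complex spaces\<close>

text \<open>Complex spaces are reduced. A complex space is given by an atlas of charts on the type
  \<open>'x\<close> of its points; a chart is a homeomorphism of an open set of points onto an analytic subset
  of an open set \<open>amb\<close> of some \<open>\<complex>\<^sup>n\<close>. All charts of one atlas use the same \<open>n\<close>, which
  is an upper bound for the local embedding dimensions, not the dimension of the space. A compact
  space has a finite atlas, and padding by zeros brings its charts into a common \<open>\<complex>\<^sup>n\<close>,
  so for compact spaces nothing is lost.\<close>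

record ('x, 'n) chart =
  cdom :: "'x set"
  amb :: "(complex^'n) set"
  crd :: "'x \<Rightarrow> complex^'n"

definition cinv :: "('x, 'n::finite) chart \<Rightarrow> complex^'n \<Rightarrow> 'x" where
  "cinv c = inv_into (cdom c) (crd c)"

definition valid_chart :: "('x::topological_space, 'n::finite) chart \<Rightarrow> bool" where
  "valid_chart c \<longleftrightarrow> open (cdom c) \<and> analytic_subset (amb c) (crd c ` cdom c) \<and>
     homeomorphism (cdom c) (crd c ` cdom c) (crd c) (cinv c)"

definition holo_transition ::
  "('x::topological_space, 'n::finite) chart \<Rightarrow> ('x, 'n) chart \<Rightarrow> bool" where
  "holo_transition c c' \<longleftrightarrow>
     (\<forall>i. sub_holo (crd c ` (cdom c \<inter> cdom c')) (\<lambda>z. crd c' (cinv c z) $ i))"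

definition complex_space :: "('x::t2_space, 'n::finite) chart set \<Rightarrow> bool" where
  "complex_space X \<longleftrightarrow> (\<Union>c\<in>X. cdom c) = UNIV \<and> (\<forall>c\<in>X. valid_chart c) \<and>
     (\<forall>c\<in>X. \<forall>c'\<in>X. holo_transition c c')"

definition holo_fun ::
  "('x::t2_space, 'n::finite) chart set \<Rightarrow> 'x set \<Rightarrow> ('x \<Rightarrow> complex) \<Rightarrow> bool" where
  "holo_fun X U f \<longleftrightarrow> open U \<and> (\<forall>c\<in>X. sub_holo (crd c ` (cdom c \<inter> U)) (\<lambda>z. f (cinv c z)))"

definition closed_analytic_subset ::
  "('x::t2_space, 'n::finite) chart set \<Rightarrow> 'x set \<Rightarrow> bool" where
  "closed_analytic_subset X S \<longleftrightarrow> closed S \<and>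
     (\<forall>x. \<exists>U Fs. open U \<and> x \<in> U \<and> finite Fs \<and> (\<forall>f\<in>Fs. holo_fun X U f) \<and>
        U \<inter> S = {w\<in>U. \<forall>f\<in>Fs. f w = 0})"

definition complex_hypersurface ::
  "('x::t2_space, 'n::finite) chart set \<Rightarrow> 'x set \<Rightarrow> bool" where
  "complex_hypersurface X S \<longleftrightarrow> closed_analytic_subset X S \<and>
     (\<forall>x\<in>S. \<exists>U f. open U \<and> x \<in> U \<and> holo_fun X U f \<and> U \<inter> S = {w\<in>U. f w = 0})"


section \<open>Hermitian metrics\<close>

definition herm_form :: "complex^'n^'n::finite \<Rightarrow> complex^'n \<Rightarrow> complex^'n \<Rightarrow> complex" where
  "herm_form H v w = (\<Sum>i\<in>UNIV. \<Sum>j\<in>UNIV. H $ i $ j * v $ i * cnj (w $ j))"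

definition pos_def_hermitian :: "complex^'n^'n::finite \<Rightarrow> bool" where
  "pos_def_hermitian H \<longleftrightarrow> (\<forall>i j. H $ i $ j = cnj (H $ j $ i)) \<and>
     (\<forall>v. v \<noteq> 0 \<longrightarrow> 0 < Re (herm_form H v v))"

text \<open>A hermitian metric on a complex space is locally the restriction of a smooth hermitian
  metric of an ambient \<open>\<complex>\<^sup>n\<close> to the Zariski tangent spaces. It is presented by one ambient
  metric \<open>E c\<close> for each chart \<open>c\<close>. In the overlap condition \<open>\<psi>\<close> is a local
  holomorphic extension of the change of charts; only tangent vectors are compared, since the
  ambient metrics and the derivative of \<open>\<psi>\<close> have no meaning on \<open>X\<close> in other directions.\<close>

definition hermitian_metric ::
  "('x::t2_space, 'n::finite) chart set \<Rightarrow>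
   (('x, 'n) chart \<Rightarrow> complex^'n \<Rightarrow> complex^'n^'n) \<Rightarrow> bool" where
  "hermitian_metric X E \<longleftrightarrow>
     (\<forall>c\<in>X. (\<forall>z\<in>amb c. pos_def_hermitian (E c z)) \<and>
            (\<forall>i j. smooth_on (\<lambda>z. E c z $ i $ j) (amb c))) \<and>
     (\<forall>c\<in>X. \<forall>c'\<in>X. \<forall>x\<in>cdom c \<inter> cdom c'. \<forall>U \<psi>.
        crd c x \<in> U \<longrightarrow> holo_map_on \<psi> U \<longrightarrow>
        (\<forall>y\<in>cdom c \<inter> cdom c'. crd c y \<in> U \<longrightarrow> \<psi> (crd c y) = crd c' y) \<longrightarrow>
        (\<forall>v\<in>zariski_tangent (crd c ` cdom c) (crd c x).
         \<forall>w\<in>zariski_tangent (crd c ` cdom c) (crd c x).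
           herm_form (E c' (crd c' x)) (frechet_derivative \<psi> (at (crd c x)) v)
                                       (frechet_derivative \<psi> (at (crd c x)) w)
           = herm_form (E c (crd c x)) v w))"


section \<open>Holomorphic maps from plane domains\<close>

definition holo_curve_on ::
  "('x::t2_space, 'n::finite) chart set \<Rightarrow> complex set \<Rightarrow> (complex \<Rightarrow> 'x) \<Rightarrow> bool" where
  "holo_curve_on X \<Omega> f \<longleftrightarrow> open \<Omega> \<and> continuous_on \<Omega> f \<and>
     (\<forall>c\<in>X. \<forall>i. (\<lambda>z. crd c (f z) $ i) holomorphic_on {z\<in>\<Omega>. f z \<in> cdom c})"

text \<open>\<open>Hol X \<Omega> M\<close> is \<open>Hol(\<Omega>, M)\<close> for an open subset \<open>M\<close> of the space. Maps are
  extensional (\<open>undefined\<close> outside \<open>\<Omega>\<close>), so that equality is equality on \<open>\<Omega>\<close>.\<close>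

definition Hol ::
  "('x::t2_space, 'n::finite) chart set \<Rightarrow> complex set \<Rightarrow> 'x set \<Rightarrow> (complex \<Rightarrow> 'x) set" where
  "Hol X \<Omega> M = {f \<in> \<Omega> \<rightarrow>\<^sub>E M. holo_curve_on X \<Omega> f}"

definition compact_open_topology ::
  "('x::t2_space, 'n::finite) chart set \<Rightarrow> complex set \<Rightarrow> 'x set \<Rightarrow> (complex \<Rightarrow> 'x) topology" where
  "compact_open_topology X \<Omega> M = topology_generated_by
     {{f \<in> Hol X \<Omega> M. f ` K \<subseteq> U} | K U. compact K \<and> K \<subseteq> \<Omega> \<and> openin (top_of_set M) U}"

definition normal_family ::
  "('x::t2_space, 'n::finite) chart set \<Rightarrow> complex set \<Rightarrow> 'x set \<Rightarrow> (complex \<Rightarrow> 'x) set \<Rightarrow> bool" where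
  "normal_family X \<Omega> M F \<longleftrightarrow>
     compactin (compact_open_topology X \<Omega> M) (compact_open_topology X \<Omega> M closure_of F)"

text \<open>The \<open>E\<close>-length of \<open>g'(z)\<close>, computed in some chart around \<open>g z\<close>. The value does
  not depend on the chart, because the derivative of a holomorphic curve in coordinates lies in
  the Zariski tangent space.\<close>

definition E_length ::
  "('x::t2_space, 'n::finite) chart set \<Rightarrow>
   (('x, 'n) chart \<Rightarrow> complex^'n \<Rightarrow> complex^'n^'n) \<Rightarrow> (complex \<Rightarrow> 'x) \<Rightarrow> complex \<Rightarrow> real" where
  "E_length X E g z =
     (let c = (SOME c. c \<in> X \<and> g z \<in> cdom c);
          v = (\<chi> i. deriv (\<lambda>\<zeta>. crd c (g \<zeta>) $ i) z)
      in sqrt (Re (herm_form (E c (crd c (g z))) v v)))"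

definition E_Brody_curve ::
  "('x::t2_space, 'n::finite) chart set \<Rightarrow>
   (('x, 'n) chart \<Rightarrow> complex^'n \<Rightarrow> complex^'n^'n) \<Rightarrow> 'x set \<Rightarrow> (complex \<Rightarrow> 'x) \<Rightarrow> bool" where
  "E_Brody_curve X E M g \<longleftrightarrow> g \<in> Hol X UNIV M \<and> bounded (range (E_length X E g))"

text \<open>For sequences of maps \<open>g j\<close>, each defined on \<open>Dm j \<subseteq> \<complex>\<close> only, where every compact
  subset of \<open>\<complex>\<close> lies in \<open>Dm j\<close> for all large \<open>j\<close>. The metric of the type \<open>'x\<close> is
  any metric inducing the topology: a compact complex space is metrizable, and by compactness all
  such metrics give the same uniform convergence.\<close>

definition compactly_divergent ::
  "'x::topological_space set \<Rightarrow> (nat \<Rightarrow> complex set) \<Rightarrow> (nat \<Rightarrow> complex \<Rightarrow> 'x) \<Rightarrow> bool" where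
  "compactly_divergent M Dm g \<longleftrightarrow>
     (\<forall>K L. compact K \<longrightarrow> compact L \<longrightarrow> L \<subseteq> M \<longrightarrow>
        (\<exists>j0. \<forall>j\<ge>j0. K \<subseteq> Dm j \<and> g j ` K \<inter> L = {}))"

definition locally_uniformly_convergent ::
  "(nat \<Rightarrow> complex set) \<Rightarrow> (nat \<Rightarrow> complex \<Rightarrow> 'x::metric_space) \<Rightarrow> (complex \<Rightarrow> 'x) \<Rightarrow> bool" where
  "locally_uniformly_convergent Dm g h \<longleftrightarrow>
     (\<forall>K. compact K \<longrightarrow>
        (\<exists>j0. \<forall>j\<ge>j0. K \<subseteq> Dm j) \<and> uniform_limit K g h sequentially)"

end

theory Submission
  imports Defs
begin

text \<open>As \<open>X\<close> is compact, curves with locally bounded \<open>E\<close>-length are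
  equicontinuous. If \<open>F\<close> has locally bounded \<open>E\<close>-length, then every sequence in
  \<open>F\<close> subconverges to a holomorphic map into \<open>X\<close>; by Hurwitz its image lies in
  \<open>M\<close> or in \<open>S\<close>. Non-normality gives a limit in \<open>S\<close>, and any rescaling of
  the sequence about a fixed point is compactly divergent. Otherwise Zalcman's rescaling at almost
  maximal points of the \<open>E\<close>-length gives a non-constant limit curve of bounded
  \<open>E\<close>-length, again in \<open>M\<close> or in \<open>S\<close>. Conversely, rescalings of a normal
  family cluster at constants in \<open>M\<close>.\<close>

section \<open>Holomorphic curves in charts\<close>

text \<open>The metric of the type \<open>'x\<close> merely induces the topology and is unrelated to
  \<open>E\<close>, so a bound on \<open>E_length\<close> is not by itself a Lipschitz bound.
  Equicontinuity is therefore an exit argument in a chart: the coordinate speed is bounded as long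
  as the curve stays in a compact ball, and leaving that ball takes a definite time.
  \<open>E_length\<close> picks its chart by \<open>SOME\<close> at every point. Independence of the
  chart needs that velocities of curves are Zariski tangent vectors, as the metrics of different
  charts agree only on these. Hurwitz applies because a hypersurface is locally the zero set of one
  function; this makes \<open>h z \<in> S\<close> an open condition on \<open>z\<close> besides a
  closed one. \<open>normal_family\<close> is about open covers in a topology given by a subbasis,
  whereas Montel yields subsequences. From sequences to covers the passage goes through an embedding
  into a compact metric space; from covers to sequences a map whose neighbourhoods are visited
  infinitely often takes the place of a limit of a subsequence.\<close>

lemma has_derivative_cvec:
  fixes u :: "complex \<Rightarrow> complex^'n::finite"
  assumes "\<And>i. ((\<lambda>\<zeta>. u \<zeta> $ i) has_field_derivative u' $ i) (at z)"
  shows "(u has_derivative (\<lambda>h. h *s u')) (at z)"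
proof -
  have "((\<lambda>\<zeta>. u \<zeta> \<bullet> b) has_derivative (\<lambda>h. (h *s u') \<bullet> b)) (at z)" if "b \<in> Basis" for b
  proof -
    obtain i w where b: "b = axis i w"
      using \<open>b \<in> Basis\<close> unfolding Basis_vec_def by auto
    have "((\<lambda>\<zeta>. u \<zeta> $ i \<bullet> w) has_derivative (\<lambda>h. (u' $ i * h) \<bullet> w)) (at z)"
      using assms[of i] unfolding has_field_derivative_def
      by (rule has_derivative_inner_left)
    then show ?thesis
      by (simp add: b inner_axis mult.commute)
  qed
  then show ?thesis
    by (subst has_derivative_componentwise_within) blast
qed

lemma holo_on_has_derivative:
  assumes "holo_on f U" "z \<in> U"
  shows "(f has_derivative frechet_derivative f (at z)) (at z)"
  using assms unfolding holo_on_def by (metis frechet_derivative_at)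

lemma holo_on_frechet_scale:
  assumes "holo_on f U" "z \<in> U"
  shows "frechet_derivative f (at z) (a *s v) = a * frechet_derivative f (at z) v"
  using assms unfolding holo_on_def by (metis frechet_derivative_at)

text \<open>The real chain rule gives the derivative of \<open>f\<close> applied to
  \<open>h *s u'\<close>; by complex linearity this is a multiple of \<open>h\<close>, hence a
  complex derivative.\<close>

lemma holo_on_comp_curve:
  fixes u :: "complex \<Rightarrow> complex^'n::finite"
  assumes f: "holo_on f U" "u z \<in> U"
    and u: "\<And>i. ((\<lambda>\<zeta>. u \<zeta> $ i) has_field_derivative u' $ i) (at z)"
  shows "((\<lambda>\<zeta>. f (u \<zeta>)) has_field_derivative frechet_derivative f (at (u z)) u') (at z)"
proof -
  have "((\<lambda>\<zeta>. f (u \<zeta>)) has_derivative (\<lambda>h. frechet_derivative f (at (u z)) (h *s u'))) (at z)"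
    using has_derivative_compose[OF has_derivative_cvec[OF u] holo_on_has_derivative[OF f]] .
  then show ?thesis
    by (simp add: has_field_derivative_def holo_on_frechet_scale[OF f] mult_commute_abs)
qed

lemma holo_on_subset: "holo_on f U \<Longrightarrow> open V \<Longrightarrow> V \<subseteq> U \<Longrightarrow> holo_on f V"
  unfolding holo_on_def by blast

section \<open>Velocity and length of a curve in one chart\<close>

definition chart_deriv :: "('x, 'n::finite) chart \<Rightarrow> (complex \<Rightarrow> 'x) \<Rightarrow> complex \<Rightarrow> complex^'n" where
  "chart_deriv c g z = (\<chi> i. deriv (\<lambda>\<zeta>. crd c (g \<zeta>) $ i) z)"

text \<open>\<open>E_length\<close> with the chart held fixed. Since \<open>E_length\<close> selects
  a chart anew for each curve and point, continuity and limits are first proved for this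
  expression.\<close>

definition chart_length ::
  "(('x, 'n) chart \<Rightarrow> complex^'n \<Rightarrow> complex^'n^'n) \<Rightarrow> ('x, 'n::finite) chart \<Rightarrow>
    (complex \<Rightarrow> 'x) \<Rightarrow> complex \<Rightarrow> real" where
  "chart_length E c g z =
    sqrt (Re (herm_form (E c (crd c (g z))) (chart_deriv c g z) (chart_deriv c g z)))"

lemma holo_curve_on_subset:
  "holo_curve_on X D g \<Longrightarrow> open D' \<Longrightarrow> D' \<subseteq> D \<Longrightarrow> holo_curve_on X D' g"
  unfolding holo_curve_on_def
  by (auto intro: continuous_on_subset holomorphic_on_subset)

text \<open>The whole type \<open>'x\<close> is the compact space. Its metric stands for the
  topology and for uniform convergence; lengths are measured by \<open>E\<close>.\<close>

locale compact_hermitian_space =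
  fixes X :: "('x::metric_space, 'n::finite) chart set"
    and E :: "('x, 'n) chart \<Rightarrow> complex^'n \<Rightarrow> complex^'n^'n"
  assumes space: "complex_space X"
    and cpt: "compact (UNIV :: 'x set)"
    and herm: "hermitian_metric X E"
begin

lemma chart_exists: obtains c where "c \<in> X" "x \<in> cdom c"
  using space unfolding complex_space_def by blast

lemma chart_open: "c \<in> X \<Longrightarrow> open (cdom c)"
  using space unfolding complex_space_def valid_chart_def by blast

lemma chart_continuous: "c \<in> X \<Longrightarrow> continuous_on (cdom c) (crd c)"
  using space unfolding complex_space_def valid_chart_def homeomorphism_def by blast

lemma cinv_crd: "c \<in> X \<Longrightarrow> x \<in> cdom c \<Longrightarrow> cinv c (crd c x) = x"
  using space unfolding complex_space_def valid_chart_def homeomorphism_def by blast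

lemma chart_amb: "c \<in> X \<Longrightarrow> x \<in> cdom c \<Longrightarrow> crd c x \<in> amb c"
  using space unfolding complex_space_def valid_chart_def analytic_subset_def by blast

lemma curve_preimage_open:
  assumes "holo_curve_on X D g" "open U"
  shows "open {z\<in>D. g z \<in> U}"
proof -
  have "open (D \<inter> g -` U)"
    using assms unfolding holo_curve_on_def by (blast intro: continuous_open_preimage)
  moreover have "D \<inter> g -` U = {z\<in>D. g z \<in> U}" by auto
  ultimately show ?thesis by simp
qed

lemma curve_has_derivative:
  assumes "holo_curve_on X D g" "c \<in> X" "z \<in> D" "g z \<in> cdom c"
  shows "((\<lambda>\<zeta>. crd c (g \<zeta>) $ i) has_field_derivative chart_deriv c g z $ i) (at z)"
proof -
  have "(\<lambda>\<zeta>. crd c (g \<zeta>) $ i) holomorphic_on {z\<in>D. g z \<in> cdom c}"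
    using assms unfolding holo_curve_on_def by blast
  then show ?thesis
    using curve_preimage_open[OF assms(1) chart_open[OF assms(2)]] assms
    by (simp add: chart_deriv_def holomorphic_derivI)
qed

text \<open>A function vanishing on the chart image vanishes along the curve near \<open>z\<close>,
  so its derivative kills the velocity. This puts velocities under the overlap condition of
  \<open>hermitian_metric\<close>.\<close>

lemma chart_deriv_zariski_tangent:
  assumes g: "holo_curve_on X D g" and c: "c \<in> X" and z: "z \<in> D" "g z \<in> cdom c"
  shows "chart_deriv c g z \<in> zariski_tangent (crd c ` cdom c) (crd c (g z))"
  unfolding zariski_tangent_def
proof (intro CollectI allI impI)
  fix U f
  assume U: "crd c (g z) \<in> U" and f: "holo_on f U" and 0: "\<forall>w\<in>U \<inter> crd c ` cdom c. f w = 0"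
  have D: "((\<lambda>\<zeta>. f (crd c (g \<zeta>))) has_field_derivative
      frechet_derivative f (at (crd c (g z))) (chart_deriv c g z)) (at z)"
    by (rule holo_on_comp_curve[where u = "\<lambda>\<zeta>. crd c (g \<zeta>)"])
       (use f U curve_has_derivative[OF g c z] in auto)
  have "continuous_on {\<zeta>\<in>D. g \<zeta> \<in> cdom c} (\<lambda>\<zeta>. crd c (g \<zeta>))"
    using g unfolding holo_curve_on_def
    by (intro continuous_on_compose2[OF chart_continuous[OF c]]) (auto intro: continuous_on_subset)
  then have "open ({\<zeta>\<in>D. g \<zeta> \<in> cdom c} \<inter> (\<lambda>\<zeta>. crd c (g \<zeta>)) -` U)"
    using curve_preimage_open[OF g chart_open[OF c]] f
    unfolding holo_on_def by (blast intro: continuous_open_preimage)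
  then have "\<forall>\<^sub>F \<zeta> in nhds z. \<zeta> \<in> {\<zeta>\<in>D. g \<zeta> \<in> cdom c} \<inter> (\<lambda>\<zeta>. crd c (g \<zeta>)) -` U"
    using z U by (intro eventually_nhds_in_open) auto
  then have "\<forall>\<^sub>F \<zeta> in nhds z. f (crd c (g \<zeta>)) = 0"
    by eventually_elim (use 0 in auto)
  then have "((\<lambda>\<zeta>. f (crd c (g \<zeta>))) has_field_derivative 0) (at z)"
    by (subst DERIV_cong_ev[where g = "\<lambda>_. 0"]) auto
  with D show "frechet_derivative f (at (crd c (g z))) (chart_deriv c g z) = 0"
    by (rule DERIV_unique)
qed

text \<open>\<open>holo_transition\<close> extends the coordinates one by one, each on its own
  neighbourhood, while \<open>hermitian_metric\<close> speaks of one ambient map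
  \<open>\<psi>\<close>. The finitely many neighbourhoods are intersected.\<close>

lemma transition_exists:
  assumes c: "c \<in> X" "c' \<in> X" and x: "x \<in> cdom c" "x \<in> cdom c'"
  obtains U \<psi> where "crd c x \<in> U" "holo_map_on \<psi> U" "open U"
    "\<And>y. y \<in> cdom c \<inter> cdom c' \<Longrightarrow> crd c y \<in> U \<Longrightarrow> \<psi> (crd c y) = crd c' y"
proof -
  have "holo_transition c c'"
    using space c unfolding complex_space_def by blast
  then have "\<forall>i. \<exists>U g. open U \<and> crd c x \<in> U \<and> holo_on g U \<and>
      (\<forall>w\<in>U \<inter> crd c ` (cdom c \<inter> cdom c'). g w = crd c' (cinv c w) $ i)"
    unfolding holo_transition_def sub_holo_def using x by blast
  then obtain U g where U: "\<And>i. open (U i) \<and> crd c x \<in> U i \<and> holo_on (g i) (U i) \<and>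
      (\<forall>w\<in>U i \<inter> crd c ` (cdom c \<inter> cdom c'). g i w = crd c' (cinv c w) $ i)"
    by metis
  show thesis
  proof
    show o: "open (\<Inter>i. U i)" using U by (intro open_INT) auto
    show "crd c x \<in> (\<Inter>i. U i)" using U by auto
    show "holo_map_on (\<lambda>w. \<chi> i. g i w) (\<Inter>i. U i)"
      unfolding holo_map_on_def using U o by (auto intro: holo_on_subset)
    fix y assume y: "y \<in> cdom c \<inter> cdom c'" "crd c y \<in> (\<Inter>i. U i)"
    then have "g i (crd c y) = crd c' (cinv c (crd c y)) $ i" for i
      using U[of i] by blast
    then show "(\<chi> i. g i (crd c y)) = crd c' y"
      using y c by (simp add: vec_eq_iff cinv_crd)
  qed
qed

text \<open>Near \<open>z\<close> the second coordinate expression of the curve is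
  \<open>\<psi>\<close> after the first, so the derivative of \<open>\<psi>\<close> maps one
  velocity to the other. Both are measured equally because the first is a Zariski tangent
  vector.\<close>

lemma chart_length_eq:
  assumes g: "holo_curve_on X D g" and z: "z \<in> D"
    and c: "c \<in> X" "c' \<in> X" and x: "g z \<in> cdom c" "g z \<in> cdom c'"
  shows "chart_length E c' g z = chart_length E c g z"
proof -
  obtain U \<psi> where U: "crd c (g z) \<in> U" "holo_map_on \<psi> U" "open U"
    and \<psi>: "\<And>y. y \<in> cdom c \<inter> cdom c' \<Longrightarrow> crd c y \<in> U \<Longrightarrow> \<psi> (crd c y) = crd c' y"
    using transition_exists[OF c x] by metis
  let ?v = "chart_deriv c g z" and ?D = "frechet_derivative \<psi> (at (crd c (g z)))"
  \<comment> \<open>\<open>L\<close> is built from the scalar components of \<open>\<psi>\<close>,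
    to which \<open>holo_on\<close> applies; it is then recognised as the derivative of
    \<open>\<psi>\<close> itself.\<close>
  define L where "L = (\<lambda>v. \<chi> i. frechet_derivative (\<lambda>w. \<psi> w $ i) (at (crd c (g z))) v)"
  have comp: "((\<lambda>w. \<psi> w $ i) has_derivative (\<lambda>v. L v $ i)) (at (crd c (g z)))" for i
    using U(1,2) holo_on_has_derivative unfolding holo_map_on_def L_def by fastforce
  have "(\<psi> has_derivative L) (at (crd c (g z)))"
    unfolding has_derivative_componentwise_within[where f = \<psi>]
  proof
    fix b :: "complex^'n" assume "b \<in> Basis"
    then obtain i w where b: "b = axis i w"
      unfolding Basis_vec_def by auto
    show "((\<lambda>x. \<psi> x \<bullet> b) has_derivative (\<lambda>x. L x \<bullet> b)) (at (crd c (g z)))"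
      using has_derivative_inner_left[OF comp[of i], of w] by (simp add: b inner_axis)
  qed
  then have D: "?D = L" using frechet_derivative_at by metis
  have "?D ?v = chart_deriv c' g z"
    unfolding D vec_eq_iff
  proof
    fix i
    have 1: "((\<lambda>\<zeta>. \<psi> (crd c (g \<zeta>)) $ i) has_field_derivative L ?v $ i) (at z)"
      using holo_on_comp_curve[where u = "\<lambda>\<zeta>. crd c (g \<zeta>)" and f = "\<lambda>w. \<psi> w $ i" and U = U,
          OF _ _ curve_has_derivative[OF g c(1) z x(1)]] U
      unfolding holo_map_on_def L_def by simp
    have "continuous_on {\<zeta>\<in>D. g \<zeta> \<in> cdom c} (\<lambda>\<zeta>. crd c (g \<zeta>))"
      using g unfolding holo_curve_on_def
      by (intro continuous_on_compose2[OF chart_continuous[OF c(1)]])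
         (auto intro: continuous_on_subset)
    then have "open ({\<zeta>\<in>D. g \<zeta> \<in> cdom c} \<inter> (\<lambda>\<zeta>. crd c (g \<zeta>)) -` U)"
      using curve_preimage_open[OF g chart_open[OF c(1)]] U(3)
      by (blast intro: continuous_open_preimage)
    then have "\<forall>\<^sub>F \<zeta> in nhds z. \<zeta> \<in> {\<zeta>\<in>D. g \<zeta> \<in> cdom c} \<inter> (\<lambda>\<zeta>. crd c (g \<zeta>)) -` U"
      using z x U by (intro eventually_nhds_in_open) auto
    moreover have "\<forall>\<^sub>F \<zeta> in nhds z. \<zeta> \<in> {\<zeta>\<in>D. g \<zeta> \<in> cdom c'}"
      using curve_preimage_open[OF g chart_open[OF c(2)]] z x
      by (intro eventually_nhds_in_open) auto
    ultimately have "\<forall>\<^sub>F \<zeta> in nhds z. crd c' (g \<zeta>) $ i = \<psi> (crd c (g \<zeta>)) $ i"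
      by eventually_elim (use \<psi> in auto)
    then have "((\<lambda>\<zeta>. crd c' (g \<zeta>) $ i) has_field_derivative L ?v $ i) (at z)"
      using 1 by (subst DERIV_cong_ev[where g = "\<lambda>\<zeta>. \<psi> (crd c (g \<zeta>)) $ i"]) auto
    then show "L ?v $ i = chart_deriv c' g z $ i"
      using curve_has_derivative[OF g c(2) z x(2)] DERIV_unique by blast
  qed
  moreover have "herm_form (E c' (crd c' (g z))) (?D ?v) (?D ?v)
      = herm_form (E c (crd c (g z))) ?v ?v"
    using herm c x U \<psi> chart_deriv_zariski_tangent[OF g c(1) z x(1)]
    unfolding hermitian_metric_def by blast
  ultimately show ?thesis
    unfolding chart_length_def by simp
qed

lemma E_length_chart:
  assumes "holo_curve_on X D g" "z \<in> D" "c \<in> X" "g z \<in> cdom c"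
  shows "E_length X E g z = chart_length E c g z"
proof -
  let ?c = "SOME c. c \<in> X \<and> g z \<in> cdom c"
  have "?c \<in> X \<and> g z \<in> cdom ?c"
    by (rule someI[of _ c]) (use assms in auto)
  then show ?thesis
    using chart_length_eq[OF assms(1,2,3), of ?c] assms
    by (simp add: E_length_def Let_def chart_length_def chart_deriv_def)
qed

end

section \<open>Lengths and limits of holomorphic curves\<close>

lemma norm_vec_smult:
  fixes v :: "complex^'n::finite"
  shows "norm (h *s v) = norm h * norm v"
  by (simp add: norm_vec_def L2_set_right_distrib norm_mult)

lemma herm_form_scaleR: "herm_form H (r *\<^sub>R v) (r *\<^sub>R v) = of_real (r\<^sup>2) * herm_form H v v"
  unfolding herm_form_def sum_distrib_left
  by (intro sum.cong refl) (simp add: scaleR_conv_of_real[where 'a = complex] power2_eq_square)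

lemma tendsto_herm_form:
  fixes H :: "'t \<Rightarrow> complex^'n^'n::finite"
  assumes "\<And>i j. ((\<lambda>t. H t $ i $ j) \<longlongrightarrow> H0 $ i $ j) F"
    and "(v \<longlongrightarrow> v0) F" "(w \<longlongrightarrow> w0) F"
  shows "((\<lambda>t. herm_form (H t) (v t) (w t)) \<longlongrightarrow> herm_form H0 v0 w0) F"
  unfolding herm_form_def by (intro tendsto_intros assms)

context compact_hermitian_space
begin

section \<open>Comparison with the coordinate norm, and continuity of the length\<close>

lemma closed_compact: "closed A \<Longrightarrow> compact (A :: 'x set)"
  using compact_Int_closed[OF cpt] by simp

lemma metric_continuous:
  assumes "c \<in> X"
  shows "continuous_on (amb c) (\<lambda>z. E c z $ i $ j)"
proof -
  have "Ck_on 0 (\<lambda>z. E c z $ i $ j) (amb c)"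
    using herm assms unfolding hermitian_metric_def smooth_on_def by blast
  then show ?thesis by simp
qed

lemma metric_tendsto:
  assumes "c \<in> X" "x \<in> cdom c" "((\<lambda>t. y t) \<longlongrightarrow> x) F" "\<forall>\<^sub>F t in F. y t \<in> cdom c"
  shows "((\<lambda>t. E c (crd c (y t)) $ i $ j) \<longlongrightarrow> E c (crd c x) $ i $ j) F"
proof -
  have "continuous_on (cdom c) (\<lambda>x. E c (crd c x) $ i $ j)"
    by (intro continuous_on_compose2[OF metric_continuous chart_continuous])
       (use assms chart_amb in auto)
  then show ?thesis
    by (rule continuous_on_tendsto_compose) (use assms in auto)
qed

text \<open>By homogeneity only unit vectors matter, and a positive continuous function on the
  compact set \<open>K \<times> sphere 0 1\<close> has a positive minimum. The constant turns bounds
  on the \<open>E\<close>-length into bounds on the coordinate speed.\<close>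

lemma chart_comparable:
  assumes c: "c \<in> X" and K: "compact K" "K \<subseteq> cdom c"
  obtains a where "a > 0"
    "\<And>x v. x \<in> K \<Longrightarrow> a * norm v \<le> sqrt (Re (herm_form (E c (crd c x)) v v))"
proof (cases "K = {}")
  case False
  define \<phi> where "\<phi> = (\<lambda>(x, v). Re (herm_form (E c (crd c x)) v v))"
  let ?P = "K \<times> sphere (0 :: complex^'n) 1"
  have "continuous_on ?P \<phi>"
    unfolding continuous_on_def
  proof
    fix p assume "p \<in> ?P"
    then obtain x v where p: "p = (x, v)" "x \<in> K" by auto
    have "(fst \<longlongrightarrow> x) (at p within ?P)" "(snd \<longlongrightarrow> v) (at p within ?P)"
      using p tendsto_fst[OF tendsto_ident_at, of p ?P] tendsto_snd[OF tendsto_ident_at, of p ?P]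
      by auto
    moreover have "\<forall>\<^sub>F q in at p within ?P. fst q \<in> cdom c"
      using K by (auto simp: eventually_at_filter intro!: always_eventually)
    ultimately have "((\<lambda>q. Re (herm_form (E c (crd c (fst q))) (snd q) (snd q)))
        \<longlongrightarrow> Re (herm_form (E c (crd c x)) v v)) (at p within ?P)"
      using p K by (intro tendsto_Re tendsto_herm_form metric_tendsto c) auto
    then show "(\<phi> \<longlongrightarrow> \<phi> p) (at p within ?P)"
      by (simp add: \<phi>_def p case_prod_unfold)
  qed
  moreover have "compact ?P" using K by (intro compact_Times) auto
  moreover have "?P \<noteq> {}"
    using False by (auto simp: sphere_empty)
  ultimately obtain p where p: "p \<in> ?P" "\<And>q. q \<in> ?P \<Longrightarrow> \<phi> p \<le> \<phi> q"
    using continuous_attains_inf by metis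
  have "\<phi> p > 0"
  proof -
    obtain x v where xv: "p = (x, v)" "x \<in> K" "norm v = 1" using p(1) by auto
    then have "v \<noteq> 0" by auto
    moreover have "pos_def_hermitian (E c (crd c x))"
      using herm c xv K chart_amb unfolding hermitian_metric_def by blast
    ultimately show ?thesis
      using xv unfolding pos_def_hermitian_def \<phi>_def by auto
  qed
  show thesis
  proof
    show "sqrt (\<phi> p) > 0" using \<open>\<phi> p > 0\<close> by simp
    fix x v assume x: "x \<in> K"
    show "sqrt (\<phi> p) * norm v \<le> sqrt (Re (herm_form (E c (crd c x)) v v))"
    proof (cases "v = 0")
      case True
      then show ?thesis by (simp add: herm_form_def)
    next
      case False
      define w where "w = (1 / norm v) *\<^sub>R v"
      have w: "norm w = 1" "v = norm v *\<^sub>R w" using False by (auto simp: w_def)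
      have "\<phi> p \<le> \<phi> (x, w)" using p(2) x w by auto
      then have "\<phi> p * (norm v)\<^sup>2 \<le> Re (herm_form (E c (crd c x)) w w) * (norm v)\<^sup>2"
        by (intro mult_right_mono) (auto simp: \<phi>_def)
      also have "\<dots> = Re (herm_form (E c (crd c x)) v v)"
        by (subst (2 3) w(2), subst herm_form_scaleR) simp
      finally have "sqrt (\<phi> p * (norm v)\<^sup>2) \<le> sqrt (Re (herm_form (E c (crd c x)) v v))"
        by (rule real_sqrt_le_mono)
      then show ?thesis by (simp add: real_sqrt_mult)
    qed
  qed
next
  case True
  then show ?thesis using that[of 1] by auto
qed

text \<open>Curve and point vary together, so one statement serves both continuity in the point and
  convergence along a sequence of curves.\<close>

lemma chart_length_tendsto:
  assumes "c \<in> X" "h z \<in> cdom c" "((\<lambda>t. g t (\<zeta> t)) \<longlongrightarrow> h z) F" "\<forall>\<^sub>F t in F. g t (\<zeta> t) \<in> cdom c"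
    and "\<And>i. ((\<lambda>t. chart_deriv c (g t) (\<zeta> t) $ i) \<longlongrightarrow> chart_deriv c h z $ i) F"
  shows "((\<lambda>t. chart_length E c (g t) (\<zeta> t)) \<longlongrightarrow> chart_length E c h z) F"
  unfolding chart_length_def
  by (intro tendsto_real_sqrt tendsto_Re tendsto_herm_form metric_tendsto vec_tendstoI assms)

text \<open>Near \<open>z\<close> the chart found at \<open>z\<close> replaces all the charts that
  \<open>SOME\<close> may pick. Continuity provides the maximum in the rescaling argument.\<close>

lemma E_length_continuous:
  assumes g: "holo_curve_on X D g"
  shows "continuous_on D (E_length X E g)"
  unfolding continuous_on_def
proof
  fix z assume z: "z \<in> D"
  obtain c where c: "c \<in> X" "g z \<in> cdom c" by (rule chart_exists)
  let ?V = "{\<zeta>\<in>D. g \<zeta> \<in> cdom c}"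
  have V: "open ?V" "z \<in> ?V"
    using curve_preimage_open[OF g chart_open[OF c(1)]] z c by auto
  have ev: "\<forall>\<^sub>F \<zeta> in at z. \<zeta> \<in> ?V"
    using V by (rule eventually_at_in_open')
  have "isCont g z"
    using g z unfolding holo_curve_on_def by (metis continuous_on_eq_continuous_at)
  moreover have "((\<lambda>\<zeta>. chart_deriv c g \<zeta> $ i) \<longlongrightarrow> chart_deriv c g z $ i) (at z)" for i
  proof -
    have "deriv (\<lambda>\<zeta>. crd c (g \<zeta>) $ i) holomorphic_on ?V"
      using g c V(1) unfolding holo_curve_on_def by (intro holomorphic_deriv) auto
    then have "isCont (deriv (\<lambda>\<zeta>. crd c (g \<zeta>) $ i)) z"
      using V holomorphic_on_imp_continuous_on continuous_on_eq_continuous_at by blast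
    then show ?thesis by (simp add: isCont_def chart_deriv_def)
  qed
  ultimately have "((\<lambda>\<zeta>. chart_length E c g \<zeta>) \<longlongrightarrow> chart_length E c g z) (at z)"
    using c ev by (intro chart_length_tendsto) (auto simp: isCont_def elim: eventually_mono)
  moreover have "\<forall>\<^sub>F \<zeta> in at z. chart_length E c g \<zeta> = E_length X E g \<zeta>"
    using ev by eventually_elim (use E_length_chart[OF g _ c(1)] in auto)
  ultimately have "(E_length X E g \<longlongrightarrow> E_length X E g z) (at z)"
    using E_length_chart[OF g z c] by (simp add: tendsto_cong)
  then show "(E_length X E g \<longlongrightarrow> E_length X E g z) (at z within D)"
    by (rule tendsto_within_subset) simp
qed

text \<open>Near \<open>z\<close>, the limit and the late maps are confined to one compact ball
  inside \<open>W\<close>. Continuous functions on \<open>W\<close>, such as coordinates or local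
  equations, are uniformly continuous there and so preserve uniform convergence.\<close>

lemma uniform_limit_local:
  fixes h :: "complex \<Rightarrow> 'x"
  assumes r: "0 < r" and g: "\<forall>\<^sub>F j in sequentially. continuous_on (ball z r) (g j)"
    and lim: "uniform_limit (ball z r) g h sequentially"
    and W: "open W" "h z \<in> W"
  obtains s \<epsilon> where "s > 0" "cball z s \<subseteq> ball z r" "compact (cball (h z) \<epsilon>)" "cball (h z) \<epsilon> \<subseteq> W"
    "\<forall>\<zeta>\<in>cball z s. h \<zeta> \<in> cball (h z) \<epsilon>"
    "\<forall>\<^sub>F j in sequentially. \<forall>\<zeta>\<in>cball z s. g j \<zeta> \<in> cball (h z) \<epsilon>"
    "uniform_limit (cball z s) g h sequentially"
proof -
  obtain \<epsilon> where \<epsilon>: "\<epsilon> > 0" "cball (h z) \<epsilon> \<subseteq> W"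
    using W open_contains_cball by blast
  have cb: "compact (cball (h z) \<epsilon>)" by (rule closed_compact) simp
  have conth: "continuous_on (ball z r) h"
    by (rule uniform_limit_theorem[OF _ lim])
       (use g in auto)
  \<comment> \<open>The other half of \<open>\<epsilon>\<close> is left for the distance between
    \<open>g j\<close> and \<open>h\<close>.\<close>
  then have "open (ball z r \<inter> h -` ball (h z) (\<epsilon>/2))"
    by (intro continuous_open_preimage) auto
  moreover have "z \<in> ball z r \<inter> h -` ball (h z) (\<epsilon>/2)" using r \<epsilon> by auto
  ultimately obtain s where s: "s > 0" "cball z s \<subseteq> ball z r \<inter> h -` ball (h z) (\<epsilon>/2)"
    using open_contains_cball by metis
  have lim': "uniform_limit (cball z s) g h sequentially"
    by (rule uniform_limit_on_subset[OF lim]) (use s in auto)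
  have ev: "\<forall>\<^sub>F j in sequentially. \<forall>\<zeta>\<in>cball z s. g j \<zeta> \<in> cball (h z) \<epsilon>"
    using uniform_limitD[OF lim' half_gt_zero[OF \<epsilon>(1)]]
  proof eventually_elim
    case (elim j)
    show ?case
    proof
      fix \<zeta> assume \<zeta>: "\<zeta> \<in> cball z s"
      then have "dist (g j \<zeta>) (h \<zeta>) < \<epsilon>/2" "dist (h z) (h \<zeta>) < \<epsilon>/2"
        using elim s by auto
      then show "g j \<zeta> \<in> cball (h z) \<epsilon>"
        using dist_triangle_half_l[of "h z" "h \<zeta>" \<epsilon> "g j \<zeta>"] by simp
    qed
  qed
  have sub: "cball z s \<subseteq> ball z r" using s(2) by blast
  have "h \<zeta> \<in> cball (h z) \<epsilon>" if "\<zeta> \<in> cball z s" for \<zeta>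
  proof -
    have "h \<zeta> \<in> ball (h z) (\<epsilon>/2)" using s(2) that by blast
    then show ?thesis using \<epsilon>(1) by simp
  qed
  then show thesis
    by (intro that[of s \<epsilon>, OF s(1) sub cb \<epsilon>(2) _ ev lim']) blast
qed

text \<open>Weierstrass' convergence theorem in one coordinate. Holomorphy of \<open>h\<close> is an
  outcome here, and so is the convergence of the velocities.\<close>

lemma chart_deriv_limit:
  assumes r: "0 < r" and g: "\<forall>\<^sub>F j in sequentially. holo_curve_on X (ball z r) (g j)"
    and lim: "uniform_limit (ball z r) g h sequentially"
    and c: "c \<in> X" "h z \<in> cdom c"
  shows "((\<lambda>\<zeta>. crd c (h \<zeta>) $ i) has_field_derivative chart_deriv c h z $ i) (at z)"
    and "(\<lambda>j. chart_deriv c (g j) z $ i) \<longlonglongrightarrow> chart_deriv c h z $ i"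
proof -
  have cont: "\<forall>\<^sub>F j in sequentially. continuous_on (ball z r) (g j)"
    using g unfolding holo_curve_on_def by eventually_elim blast
  obtain s \<epsilon> where s: "s > 0" "cball z s \<subseteq> ball z r"
    and \<epsilon>: "compact (cball (h z) \<epsilon>)" "cball (h z) \<epsilon> \<subseteq> cdom c"
    and "\<forall>\<zeta>\<in>cball z s. h \<zeta> \<in> cball (h z) \<epsilon>"
    and ev: "\<forall>\<^sub>F j in sequentially. \<forall>\<zeta>\<in>cball z s. g j \<zeta> \<in> cball (h z) \<epsilon>"
    and lim': "uniform_limit (cball z s) g h sequentially"
    by (rule uniform_limit_local[OF r cont lim chart_open[OF c(1)] c(2)])
  have "continuous_on (cball (h z) \<epsilon>) (\<lambda>x. crd c x $ i)"
    by (intro continuous_intros continuous_on_subset[OF chart_continuous[OF c(1)] \<epsilon>(2)])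
  then have "uniformly_continuous_on (cball (h z) \<epsilon>) (\<lambda>x. crd c x $ i)"
    by (intro compact_uniformly_continuous \<epsilon>(1))
  then have ul: "uniform_limit (cball z s) (\<lambda>j \<zeta>. crd c (g j \<zeta>) $ i) (\<lambda>\<zeta>. crd c (h \<zeta>) $ i) sequentially"
    by (rule uniform_limit_compose_uniformly_continuous_on[OF lim' _ ev]) simp
  have evD: "\<forall>\<^sub>F j in sequentially. continuous_on (cball z s) (\<lambda>\<zeta>. crd c (g j \<zeta>) $ i) \<and>
     (\<forall>w\<in>ball z s. ((\<lambda>\<zeta>. crd c (g j \<zeta>) $ i) has_field_derivative chart_deriv c (g j) w $ i) (at w))"
    using g ev
  proof eventually_elim
    case (elim j)
    have "((\<lambda>\<zeta>. crd c (g j \<zeta>) $ i) has_field_derivative chart_deriv c (g j) w $ i) (at w)"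
      if "w \<in> cball z s" for w
      by (rule curve_has_derivative[OF elim(1) c(1)]) (use that elim(2) s \<epsilon> in auto)
    moreover from this have "continuous_on (cball z s) (\<lambda>\<zeta>. crd c (g j \<zeta>) $ i)"
      by (intro continuous_at_imp_continuous_on ballI) (blast intro: DERIV_isCont)
    ultimately show ?case by auto
  qed
  obtain h' where h': "\<And>w. w \<in> ball z s \<Longrightarrow>
      ((\<lambda>\<zeta>. crd c (h \<zeta>) $ i) has_field_derivative h' w) (at w) \<and>
      (\<lambda>j. chart_deriv c (g j) w $ i) \<longlonglongrightarrow> h' w"
    using has_complex_derivative_uniform_limit[OF evD ul sequentially_bot s(1)] by blast
  moreover have "h' z = chart_deriv c h z $ i"
    using h'[of z] s by (auto simp: chart_deriv_def dest: DERIV_imp_deriv)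
  ultimately show "((\<lambda>\<zeta>. crd c (h \<zeta>) $ i) has_field_derivative chart_deriv c h z $ i) (at z)"
    and "(\<lambda>j. chart_deriv c (g j) z $ i) \<longlonglongrightarrow> chart_deriv c h z $ i"
    using s by (metis centre_in_ball)+
qed

text \<open>Both the radius and the index from which \<open>g j\<close> is holomorphic may depend on
  \<open>z\<close>: rescaled curves are controlled only on discs that grow with
  \<open>j\<close>.\<close>

definition curves_converge :: "complex set \<Rightarrow> (nat \<Rightarrow> complex \<Rightarrow> 'x) \<Rightarrow> (complex \<Rightarrow> 'x) \<Rightarrow> bool" where
  "curves_converge D g h \<longleftrightarrow> (\<forall>z\<in>D. \<exists>r>0. ball z r \<subseteq> D \<and>
     (\<forall>\<^sub>F j in sequentially. holo_curve_on X (ball z r) (g j)) \<and>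
     uniform_limit (ball z r) g h sequentially)"

lemma curves_converge_holo:
  assumes D: "open D" and conv: "curves_converge D g h"
  shows "holo_curve_on X D h"
  unfolding holo_curve_on_def
proof (intro conjI ballI allI)
  show "continuous_on D h"
  proof (intro continuous_at_imp_continuous_on ballI)
    fix z assume "z \<in> D"
    then obtain r where r: "r > 0" "\<forall>\<^sub>F j in sequentially. holo_curve_on X (ball z r) (g j)"
      "uniform_limit (ball z r) g h sequentially"
      using conv unfolding curves_converge_def by blast
    have "continuous_on (ball z r) h"
      by (rule uniform_limit_theorem[OF _ r(3)])
         (use r in \<open>auto simp: holo_curve_on_def elim: eventually_mono\<close>)
    then show "isCont h z" using r by (simp add: continuous_on_eq_continuous_at)
  qed
next
  fix c i assume c: "c \<in> X"
  have "\<exists>f'. ((\<lambda>\<zeta>. crd c (h \<zeta>) $ i) has_field_derivative f') (at z within {z\<in>D. h z \<in> cdom c})"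
    if z: "z \<in> D" "h z \<in> cdom c" for z
  proof -
    obtain r where r: "r > 0" "\<forall>\<^sub>F j in sequentially. holo_curve_on X (ball z r) (g j)"
      "uniform_limit (ball z r) g h sequentially"
      using conv z unfolding curves_converge_def by blast
    show ?thesis
      using chart_deriv_limit(1)[OF r c z(2)] has_field_derivative_at_within by blast
  qed
  then show "(\<lambda>z. crd c (h z) $ i) holomorphic_on {z\<in>D. h z \<in> cdom c}"
    unfolding holomorphic_on_def field_differentiable_def by blast
qed (use D in auto)

text \<open>Carries local bounds on the length, and the normalisation to length one at the origin,
  over to limit curves.\<close>

lemma curves_converge_E_length:
  assumes D: "open D" and conv: "curves_converge D g h" and z: "z \<in> D"
  shows "(\<lambda>j. E_length X E (g j) z) \<longlonglongrightarrow> E_length X E h z"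
proof -
  obtain r where r: "r > 0" "\<forall>\<^sub>F j in sequentially. holo_curve_on X (ball z r) (g j)"
    "uniform_limit (ball z r) g h sequentially"
    using conv z unfolding curves_converge_def by blast
  obtain c where c: "c \<in> X" "h z \<in> cdom c" by (rule chart_exists)
  have lim: "(\<lambda>j. g j z) \<longlonglongrightarrow> h z"
    using tendsto_uniform_limitI[OF r(3)] r(1) by simp
  then have ev: "\<forall>\<^sub>F j in sequentially. g j z \<in> cdom c"
    using chart_open[OF c(1)] c(2) by (rule topological_tendstoD)
  have "(\<lambda>j. chart_length E c (g j) z) \<longlonglongrightarrow> chart_length E c h z"
    by (intro chart_length_tendsto c lim ev chart_deriv_limit(2)[OF r])
  moreover have "\<forall>\<^sub>F j in sequentially. chart_length E c (g j) z = E_length X E (g j) z"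
    using ev r(2) by eventually_elim (use E_length_chart[OF _ _ c(1)] r in force)
  ultimately show ?thesis
    using E_length_chart[OF curves_converge_holo[OF D conv] z c] by (simp add: tendsto_cong)
qed

end

section \<open>Equicontinuity\<close>

text \<open>The diagonal argument in another form: \<open>nat \<Rightarrow> 'x\<close> is compact by
  Tychonoff and metrizable, hence sequentially compact.\<close>

lemma fun_convergent_subsequence:
  fixes a :: "nat \<Rightarrow> nat \<Rightarrow> 'x::metric_space"
  assumes "compact (UNIV :: 'x set)"
  obtains r l where "strict_mono r" "\<And>n. (\<lambda>j. a (r j) n) \<longlonglongrightarrow> l n"
proof -
  have "compact_space (euclidean :: 'x topology)"
    using assms by (simp add: compact_space_def compactin_euclidean_iff)
  then have "compact_space (product_topology (\<lambda>_::nat. euclidean :: 'x topology) UNIV)"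
    by (simp add: compact_space_product_topology)
  then have "compact (UNIV :: (nat \<Rightarrow> 'x) set)"
    by (simp add: euclidean_product_topology compact_space_def compactin_euclidean_iff)
  then obtain l r where r: "strict_mono r" "(a \<circ> r) \<longlonglongrightarrow> l"
    unfolding compact_eq_seq_compact_metric seq_compact_def by (metis UNIV_I)
  have "(\<lambda>j. a (r j) n) \<longlonglongrightarrow> l n" for n
    using continuous_on_tendsto_compose[OF continuous_on_product_coordinates[of n] r(2)]
    by simp
  with r(1) show thesis by (rule that)
qed

lemma tendsto_imp_dist_le:
  assumes "(f \<longlongrightarrow> a) F" "(g \<longlongrightarrow> b) F" "\<forall>\<^sub>F t in F. dist (f t) (g t) < e" "F \<noteq> bot"
  shows "dist a b \<le> e"
  by (rule tendsto_upperbound[OF tendsto_dist[OF assms(1,2)] _ assms(4)])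
     (rule eventually_mono[OF assms(3)], simp)

text \<open>Equicontinuity is asked only at single points and for late indices, which is all that
  maps on growing domains satisfy. Convergence on a dense set spreads to \<open>D\<close> by the
  Cauchy criterion, and becomes uniform on a compact set by a finite cover.\<close>

lemma arzela_ascoli_subsequence:
  fixes g :: "nat \<Rightarrow> complex \<Rightarrow> 'x::metric_space"
  assumes cpt: "compact (UNIV :: 'x set)" and D: "open D"
    and eq: "\<And>z \<epsilon>. z \<in> D \<Longrightarrow> 0 < \<epsilon> \<Longrightarrow>
      \<exists>\<delta>>0. \<forall>\<^sub>F j in sequentially. \<forall>w\<in>ball z \<delta>. dist (g j w) (g j z) < \<epsilon>"
  obtains r h where "strict_mono r"
    "\<And>K. compact K \<Longrightarrow> K \<subseteq> D \<Longrightarrow> uniform_limit K (g \<circ> r) h sequentially"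
proof -
  obtain B :: "complex set" where B: "countable B" "\<And>U. open U \<Longrightarrow> U \<noteq> {} \<Longrightarrow> \<exists>y\<in>B. y \<in> U"
    using countable_dense_setE by metis
  have "B \<noteq> {}" using B(2)[of UNIV] by auto
  \<comment> \<open>The sequence \<open>q\<close> is dense in the plane and may leave
    \<open>D\<close>; even there the maps take values in the compact type \<open>'x\<close>.\<close>
  define q where "q = from_nat_into B"
  have q: "\<exists>n. q n \<in> U" if "open U" "U \<noteq> {}" for U
    using B(2)[OF that] from_nat_into_surj[OF B(1)] unfolding q_def by metis
  obtain r l where r: "strict_mono r" and l: "\<And>n. (\<lambda>j. g (r j) (q n)) \<longlonglongrightarrow> l n"
    using fun_convergent_subsequence[OF cpt, of "\<lambda>j n. g j (q n)"] by blast
  have eqr: "\<exists>\<delta>>0. \<forall>\<^sub>F j in sequentially. \<forall>w\<in>ball z \<delta>. dist (g (r j) w) (g (r j) z) < \<epsilon>"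
    if "z \<in> D" "0 < \<epsilon>" for z \<epsilon>
    using eq[OF that] by (auto dest: eventually_subseq[OF r])
  have "\<exists>l. (\<lambda>j. g (r j) z) \<longlonglongrightarrow> l" if z: "z \<in> D" for z
  proof -
    have "Cauchy (\<lambda>j. g (r j) z)"
    proof (rule metric_CauchyI)
      fix e :: real assume "0 < e"
      then obtain \<delta> where \<delta>: "\<delta> > 0"
        "\<forall>\<^sub>F j in sequentially. \<forall>w\<in>ball z \<delta>. dist (g (r j) w) (g (r j) z) < e/3"
        using eqr[OF z, of "e/3"] by auto
      obtain n where n: "q n \<in> ball z \<delta>" using q[of "ball z \<delta>"] \<delta>(1) by auto
      obtain N1 where N1: "\<And>j. j \<ge> N1 \<Longrightarrow> dist (g (r j) (q n)) (g (r j) z) < e/3"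
        using \<delta>(2) n unfolding eventually_sequentially by blast
      have "Cauchy (\<lambda>j. g (r j) (q n))" by (rule LIMSEQ_imp_Cauchy[OF l])
      then obtain N2 where
        N2: "\<And>i j. i \<ge> N2 \<Longrightarrow> j \<ge> N2 \<Longrightarrow> dist (g (r i) (q n)) (g (r j) (q n)) < e/3"
        using metric_CauchyD[of _ "e/3"] \<open>0 < e\<close> by (metis divide_pos_pos zero_less_numeral)
      have "dist (g (r i) z) (g (r j) z) < e" if "i \<ge> max N1 N2" "j \<ge> max N1 N2" for i j
      proof -
        have "dist (g (r i) z) (g (r j) z) \<le> dist (g (r i) z) (g (r i) (q n)) +
          (dist (g (r i) (q n)) (g (r j) (q n)) + dist (g (r j) (q n)) (g (r j) z))"
          using dist_triangle[of "g (r i) z" "g (r j) z" "g (r i) (q n)"]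
            dist_triangle[of "g (r i) (q n)" "g (r j) z" "g (r j) (q n)"] by linarith
        also have "\<dots> < e/3 + (e/3 + e/3)"
          using N1[of i] N1[of j] N2[of i j] that by (intro add_strict_mono) (auto simp: dist_commute)
        finally show ?thesis by simp
      qed
      then show "\<exists>N. \<forall>i\<ge>N. \<forall>j\<ge>N. dist (g (r i) z) (g (r j) z) < e" by blast
    qed
    then show ?thesis
      using compact_imp_complete[OF cpt] unfolding complete_def by blast
  qed
  then obtain h where h: "\<And>z. z \<in> D \<Longrightarrow> (\<lambda>j. g (r j) z) \<longlonglongrightarrow> h z"
    by metis
  have "uniform_limit K (g \<circ> r) h sequentially" if K: "compact K" "K \<subseteq> D" for K
  proof (rule uniform_limitI)
    fix e :: real assume "e > 0"
    \<comment> \<open>The discs are shrunk into \<open>D\<close>, where \<open>h\<close> is a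
      pointwise limit and inherits the modulus of continuity as a non-strict bound. Three errors of
      at most \<open>e/4\<close> then stay below \<open>e\<close>.\<close>
    have "\<exists>\<delta>>0. ball z \<delta> \<subseteq> D \<and>
        (\<forall>\<^sub>F j in sequentially. \<forall>w\<in>ball z \<delta>. dist (g (r j) w) (g (r j) z) < e/4)" if "z \<in> K" for z
    proof -
      obtain \<delta> where \<delta>: "\<delta> > 0"
        "\<forall>\<^sub>F j in sequentially. \<forall>w\<in>ball z \<delta>. dist (g (r j) w) (g (r j) z) < e/4"
        using eqr[of z "e/4"] \<open>e > 0\<close> \<open>z \<in> K\<close> K by auto
      obtain \<delta>' where "\<delta>' > 0" "ball z \<delta>' \<subseteq> D"
        using D \<open>z \<in> K\<close> K open_contains_ball by blast
      with \<delta> show ?thesis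
        by (intro exI[of _ "min \<delta> \<delta>'"]) (auto elim!: eventually_mono)
    qed
    then have "\<forall>z\<in>K. \<exists>\<delta>. \<delta> > 0 \<and> ball z \<delta> \<subseteq> D \<and>
        (\<forall>\<^sub>F j in sequentially. \<forall>w\<in>ball z \<delta>. dist (g (r j) w) (g (r j) z) < e/4)" by blast
    from bchoice[OF this] obtain \<delta> where "\<forall>z\<in>K. \<delta> z > 0 \<and> ball z (\<delta> z) \<subseteq> D \<and>
        (\<forall>\<^sub>F j in sequentially. \<forall>w\<in>ball z (\<delta> z). dist (g (r j) w) (g (r j) z) < e/4)" ..
    then have \<delta>: "\<And>z. z \<in> K \<Longrightarrow> \<delta> z > 0" "\<And>z. z \<in> K \<Longrightarrow> ball z (\<delta> z) \<subseteq> D"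
      and eq': "\<And>z. z \<in> K \<Longrightarrow> \<forall>\<^sub>F j in sequentially. \<forall>w\<in>ball z (\<delta> z).
        dist (g (r j) w) (g (r j) z) < e/4"
      by blast+
    have "K \<subseteq> (\<Union>z\<in>K. ball z (\<delta> z))" using \<delta>(1) by force
    then obtain K' where K': "K' \<subseteq> K" "finite K'" "K \<subseteq> (\<Union>z\<in>K'. ball z (\<delta> z))"
      using compactE_image[OF K(1), of K "\<lambda>z. ball z (\<delta> z)"] by auto
    have "\<forall>\<^sub>F j in sequentially. \<forall>z\<in>K'. (\<forall>w\<in>ball z (\<delta> z). dist (g (r j) w) (g (r j) z) < e/4)
        \<and> dist (g (r j) z) (h z) < e/4"
    proof (intro eventually_ball_finite[OF K'(2)] ballI eventually_conj)
      fix z assume z: "z \<in> K'"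
      then show "\<forall>\<^sub>F j in sequentially. \<forall>w\<in>ball z (\<delta> z). dist (g (r j) w) (g (r j) z) < e/4"
        using eq' K' by blast
      show "\<forall>\<^sub>F j in sequentially. dist (g (r j) z) (h z) < e/4"
        using tendstoD[OF h, of z "e/4"] z K' K \<open>e > 0\<close> by auto
    qed
    then show "\<forall>\<^sub>F j in sequentially. \<forall>w\<in>K. dist ((g \<circ> r) j w) (h w) < e"
    proof eventually_elim
      case (elim j)
      show ?case
      proof
        fix w assume "w \<in> K"
        then obtain z where z: "z \<in> K'" "w \<in> ball z (\<delta> z)" using K' by blast
        have "dist (h w) (h z) \<le> e/4"
        proof (rule tendsto_imp_dist_le[OF h h])
          show "w \<in> D" "z \<in> D" using z \<delta>(2) K' K by blast+
          show "\<forall>\<^sub>F j in sequentially. dist (g (r j) w) (g (r j) z) < e/4"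
            by (rule eventually_mono[OF eq'[of z]]) (use z K' in blast)+
        qed simp
        moreover have "dist (g (r j) w) (g (r j) z) < e/4" "dist (g (r j) z) (h z) < e/4"
          using elim z by auto
        moreover have "dist (g (r j) w) (h w) \<le>
            dist (g (r j) w) (g (r j) z) + (dist (g (r j) z) (h z) + dist (h w) (h z))"
          using dist_triangle[of "g (r j) w" "h w" "g (r j) z"]
            dist_triangle2[of "g (r j) z" "h w" "h z"] by linarith
        ultimately show "dist ((g \<circ> r) j w) (h w) < e"
          using \<open>e > 0\<close> by simp
      qed
    qed
  qed
  with r show thesis by (rule that)
qed

context compact_hermitian_space
begin

text \<open>To leave the ball about \<open>x0\<close>, a curve must cross a sphere that is at a
  positive coordinate distance from \<open>x0\<close>. Up to the first exit its coordinate speed is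
  bounded, so a small disc does not suffice for crossing. The constants depend on \<open>x0\<close>,
  \<open>\<epsilon>\<close> and \<open>C\<close>, but not on the curve or on the centre
  \<open>z0\<close>.\<close>

lemma curve_trap:
  assumes "0 < \<epsilon>"
  obtains \<delta>0 \<eta> where "0 < \<delta>0" "0 < \<eta>"
    "\<And>z0 g z \<delta>. \<lbrakk>\<delta> \<le> \<delta>0; holo_curve_on X (ball z0 \<delta>) g; \<forall>z\<in>ball z0 \<delta>. E_length X E g z \<le> C;
      dist (g z0) x0 < \<eta>; z \<in> ball z0 \<delta>\<rbrakk> \<Longrightarrow> dist (g z) x0 < \<epsilon>"
proof -
  obtain c where c: "c \<in> X" "x0 \<in> cdom c" by (rule chart_exists)
  obtain \<epsilon>1 where \<epsilon>1: "\<epsilon>1 > 0" "cball x0 \<epsilon>1 \<subseteq> cdom c"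
    using chart_open[OF c(1)] c(2) open_contains_cball by blast
  define e where "e = min \<epsilon> \<epsilon>1"
  have e: "e > 0" "e \<le> \<epsilon>" "cball x0 e \<subseteq> cdom c" using \<epsilon>1 assms by (auto simp: e_def)
  have cb: "compact (cball x0 e)" "compact (sphere x0 e)"
    by (auto intro!: closed_compact simp flip: cball_diff_eq_sphere)
  obtain a where a: "a > 0"
    "\<And>x v. x \<in> cball x0 e \<Longrightarrow> a * norm v \<le> sqrt (Re (herm_form (E c (crd c x)) v v))"
    using chart_comparable[OF c(1) cb(1) e(3)] by metis
  \<comment> \<open>\<open>s\<close> bounds from below the coordinate distance of the sphere from
    \<open>x0\<close>; it can be positive since the chart is injective and the sphere compact. An
    empty sphere admits every \<open>s\<close>.\<close>
  obtain s where s: "s > 0" "\<And>x. x \<in> sphere x0 e \<Longrightarrow> s \<le> dist (crd c x) (crd c x0)"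
  proof (cases "sphere x0 e = {}")
    case True
    then show ?thesis using that[of 1] by auto
  next
    case False
    have "continuous_on (sphere x0 e) (\<lambda>x. dist (crd c x) (crd c x0))"
      using e(3) by (intro continuous_intros continuous_on_subset[OF chart_continuous[OF c(1)]]) auto
    then obtain y where y: "y \<in> sphere x0 e"
      "\<And>x. x \<in> sphere x0 e \<Longrightarrow> dist (crd c y) (crd c x0) \<le> dist (crd c x) (crd c x0)"
      using continuous_attains_inf[OF cb(2) False] by metis
    have "crd c y \<noteq> crd c x0"
    proof
      assume "crd c y = crd c x0"
      moreover have "y \<in> cdom c" using y e by auto
      ultimately have "y = x0" using cinv_crd[OF c(1)] c(2) by metis
      then show False using y e by auto
    qed
    then show ?thesis using that[of "dist (crd c y) (crd c x0)"] y by auto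
  qed
  have "isCont (crd c) x0"
    using chart_continuous chart_open c by (metis continuous_on_eq_continuous_at)
  then obtain \<eta>1 where \<eta>1: "\<eta>1 > 0" "\<And>x. dist x x0 < \<eta>1 \<Longrightarrow> dist (crd c x) (crd c x0) < s/2"
    using s(1) unfolding continuous_at_eps_delta by (metis half_gt_zero)
  define \<eta> where "\<eta> = min \<eta>1 e"
  \<comment> \<open>A bound for the coordinate speed wherever the \<open>E\<close>-length is at most
    \<open>C\<close>; passing to \<open>\<bar>C\<bar> + 1\<close> makes it positive for every
    \<open>C\<close>.\<close>
  define B where "B = (\<bar>C\<bar> + 1) / a"
  have B: "B > 0" using a by (simp add: B_def)
  show thesis
  \<comment> \<open>At speed \<open>B\<close> a path shorter than \<open>s / (2 * B)\<close> moves
    the coordinates by less than \<open>s/2\<close>, and \<open>\<eta>\<close> puts the starting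
    point within \<open>s/2\<close> of \<open>crd c x0\<close>; together they fall short of
    \<open>s\<close>.\<close>
  proof (rule that[of "s / (2 * B)" \<eta>])
    show "s / (2 * B) > 0" "\<eta> > 0" using s B \<eta>1 e by (auto simp: \<eta>_def)
    fix z0 g z \<delta>
    assume \<delta>: "\<delta> \<le> s / (2 * B)" and g: "holo_curve_on X (ball z0 \<delta>) g"
      and C: "\<forall>z\<in>ball z0 \<delta>. E_length X E g z \<le> C" and z0: "dist (g z0) x0 < \<eta>"
      and z: "z \<in> ball z0 \<delta>"
    show "dist (g z) x0 < \<epsilon>"
    proof (rule ccontr)
      assume "\<not> dist (g z) x0 < \<epsilon>"
      then have far: "e \<le> dist (g z) x0" using e by simp
      define \<gamma> where "\<gamma> = (\<lambda>t::real. z0 + of_real t * (z - z0))"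
      have \<gamma>: "norm (\<gamma> t - z0) \<le> norm (z - z0)" if "t \<in> {0..1}" for t
        using that by (auto simp: \<gamma>_def norm_mult mult_left_le_one_le)
      have \<gamma>_ball: "\<gamma> t \<in> ball z0 \<delta>" if "t \<in> {0..1}" for t
        using order.strict_trans1[OF \<gamma>[OF that], of \<delta>] z by (simp add: dist_norm norm_minus_commute)
      have "continuous_on {0..1} \<gamma>" unfolding \<gamma>_def by (intro continuous_intros)
      moreover have "\<gamma> ` {0..1} \<subseteq> ball z0 \<delta>" using \<gamma>_ball by blast
      moreover have "continuous_on (ball z0 \<delta>) g" using g unfolding holo_curve_on_def by blast
      ultimately have "continuous_on {0..1} (\<lambda>t. g (\<gamma> t))"
        by (metis continuous_on_compose2)
      then have cont: "continuous_on {0..1} (\<lambda>t. dist (g (\<gamma> t)) x0)"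
        by (intro continuous_intros)
      \<comment> \<open>The least element \<open>t1\<close> of this compact set is the time of first
        exit on the segment from \<open>z0\<close> to \<open>z\<close>; by the intermediate value
        theorem the distance at \<open>t1\<close> is exactly \<open>e\<close>.\<close>
      define T where "T = {t\<in>{0..1}. e \<le> dist (g (\<gamma> t)) x0}"
      have "closed ({0..1} \<inter> (\<lambda>t. dist (g (\<gamma> t)) x0) -` {e..})"
        by (intro continuous_closed_preimage cont) auto
      moreover have "{0..1} \<inter> (\<lambda>t. dist (g (\<gamma> t)) x0) -` {e..} = T"
        by (auto simp: T_def)
      ultimately have "compact T"
        by (simp add: compact_eq_bounded_closed) (auto simp: T_def intro: bounded_subset[of "{0..1}"])
      moreover have "1 \<in> T" using far by (simp add: T_def \<gamma>_def)
      ultimately obtain t1 where t1: "t1 \<in> T" "\<And>t. t \<in> T \<Longrightarrow> t1 \<le> t"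
        using compact_attains_inf[of T] by auto
      have t1_01: "t1 \<in> {0..1}" using t1 by (simp add: T_def)
      have "\<exists>t\<ge>0. t \<le> t1 \<and> dist (g (\<gamma> t)) x0 = e"
      proof (rule IVT')
        show "dist (g (\<gamma> 0)) x0 \<le> e" using z0 by (simp add: \<gamma>_def \<eta>_def)
        show "e \<le> dist (g (\<gamma> t1)) x0" using t1 by (simp add: T_def)
        show "continuous_on {0..t1} (\<lambda>t. dist (g (\<gamma> t)) x0)"
          by (rule continuous_on_subset[OF cont]) (use t1_01 in auto)
      qed (use t1_01 in auto)
      then obtain t where "0 \<le> t" "t \<le> t1" "dist (g (\<gamma> t)) x0 = e" by blast
      moreover from this have "t1 \<le> t" using t1 t1_01 by (auto simp: T_def)
      ultimately have exit: "dist (g (\<gamma> t1)) x0 = e" by simp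
      let ?S = "closed_segment z0 (\<gamma> t1)"
      \<comment> \<open>Until the first exit the curve stays in the closed ball on which the chart
        is defined and the constant \<open>a\<close> is valid.\<close>
      have seg: "w \<in> ball z0 \<delta> \<and> g w \<in> cball x0 e" if "w \<in> ?S" for w
      proof -
        obtain u where u: "0 \<le> u" "u \<le> 1" "w = (1 - u) *\<^sub>R z0 + u *\<^sub>R \<gamma> t1"
          using \<open>w \<in> ?S\<close> unfolding closed_segment_def by blast
        then have w: "w = \<gamma> (u * t1)"
          by (simp add: \<gamma>_def scaleR_conv_of_real algebra_simps)
        have ut: "0 \<le> u * t1" "u * t1 \<le> t1"
          using u t1_01 by (auto simp: mult_left_le_one_le)
        then have ut1: "u * t1 \<in> {0..1}" using t1_01 by auto
        have "dist (g (\<gamma> (u * t1))) x0 \<le> e"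
        proof (rule ccontr)
          assume *: "\<not> dist (g (\<gamma> (u * t1))) x0 \<le> e"
          then have "u * t1 \<in> T" using ut1 by (simp add: T_def)
          then have eq: "u * t1 = t1" using t1(2) ut(2) by force
          show False using * exit unfolding eq by simp
        qed
        then show ?thesis using \<gamma>_ball[OF ut1] w by (simp add: dist_commute)
      qed
      have "norm (crd c (g (\<gamma> t1)) - crd c (g z0)) \<le> B * norm (\<gamma> t1 - z0)"
      proof (rule differentiable_bound)
        fix w assume w: "w \<in> ?S"
        then have gw: "w \<in> ball z0 \<delta>" "g w \<in> cdom c" "g w \<in> cball x0 e"
          using seg[OF w] e(3) by auto
        show "((\<lambda>\<zeta>. crd c (g \<zeta>)) has_derivative (\<lambda>h. h *s chart_deriv c g w)) (at w within ?S)"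
          by (rule has_derivative_at_withinI[OF has_derivative_cvec[OF curve_has_derivative]])
             (use g c gw in auto)
        have "a * norm (chart_deriv c g w) \<le> chart_length E c g w"
          unfolding chart_length_def by (rule a(2)[OF gw(3)])
        also have "\<dots> \<le> \<bar>C\<bar> + 1"
          using C gw(1) E_length_chart[OF g gw(1) c(1) gw(2)] by force
        finally have "norm (chart_deriv c g w) \<le> B"
          using a(1) by (simp add: B_def field_simps)
        then show "onorm (\<lambda>h. h *s chart_deriv c g w) \<le> B"
          by (intro onorm_bound) (use B in \<open>auto simp: norm_vec_smult mult.commute[of B] intro: mult_left_mono\<close>)
      qed auto
      also have "\<dots> < B * (s / (2 * B))"
        using \<gamma>[OF t1_01] z \<delta> B by (intro mult_strict_left_mono) (auto simp: dist_norm norm_minus_commute)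
      also have "\<dots> = s / 2" using B by simp
      finally have "dist (crd c (g (\<gamma> t1))) (crd c (g z0)) < s / 2" by (simp add: dist_norm)
      moreover have "dist (crd c (g z0)) (crd c x0) < s / 2"
        using z0 by (intro \<eta>1) (simp add: \<eta>_def)
      ultimately have "dist (crd c (g (\<gamma> t1))) (crd c x0) < s"
        using dist_triangle_half_r[of "crd c (g z0)"] dist_commute by metis
      then show False
        using s(2)[of "g (\<gamma> t1)"] exit by (simp add: dist_commute)
    qed
  qed
qed

end

section \<open>Montel's and Hurwitz's theorems\<close>

context compact_hermitian_space
begin

text \<open>Finitely many of the traps cover the compact space, so the least of their radii works
  for all curves. Each trap uses \<open>\<epsilon>/2\<close>, as both \<open>g z\<close> and
  \<open>g z0\<close> are compared with its centre.\<close>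

lemma curves_equicontinuous:
  assumes "0 < \<epsilon>"
  obtains \<delta>0 where "0 < \<delta>0"
    "\<And>z0 g z \<delta>. \<lbrakk>\<delta> \<le> \<delta>0; holo_curve_on X (ball z0 \<delta>) g; \<forall>z\<in>ball z0 \<delta>. E_length X E g z \<le> C;
      z \<in> ball z0 \<delta>\<rbrakk> \<Longrightarrow> dist (g z) (g z0) < \<epsilon>"
proof -
  have "\<forall>x0. \<exists>p. 0 < fst p \<and> 0 < snd p \<and> (\<forall>z0 g z \<delta>. \<delta> \<le> fst p \<longrightarrow> holo_curve_on X (ball z0 \<delta>) g \<longrightarrow>
      (\<forall>z\<in>ball z0 \<delta>. E_length X E g z \<le> C) \<longrightarrow> dist (g z0) x0 < snd p \<longrightarrow> z \<in> ball z0 \<delta> \<longrightarrow>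
      dist (g z) x0 < \<epsilon>/2)"
  proof
    fix x0 :: 'x
    obtain \<delta>0 \<eta> where "0 < \<delta>0" "0 < \<eta>"
      "\<And>z0 g z \<delta>. \<lbrakk>\<delta> \<le> \<delta>0; holo_curve_on X (ball z0 \<delta>) g; \<forall>z\<in>ball z0 \<delta>. E_length X E g z \<le> C;
        dist (g z0) x0 < \<eta>; z \<in> ball z0 \<delta>\<rbrakk> \<Longrightarrow> dist (g z) x0 < \<epsilon>/2"
      using curve_trap[OF half_gt_zero[OF assms], of C x0] by blast
    then show "\<exists>p. 0 < fst p \<and> 0 < snd p \<and> (\<forall>z0 g z \<delta>. \<delta> \<le> fst p \<longrightarrow> holo_curve_on X (ball z0 \<delta>) g \<longrightarrow>
        (\<forall>z\<in>ball z0 \<delta>. E_length X E g z \<le> C) \<longrightarrow> dist (g z0) x0 < snd p \<longrightarrow> z \<in> ball z0 \<delta> \<longrightarrow>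
        dist (g z) x0 < \<epsilon>/2)"
      by (intro exI[of _ "(\<delta>0, \<eta>)"]) simp
  qed
  from choice[OF this] obtain p where p: "\<And>x. 0 < fst (p x)" "\<And>x. 0 < snd (p x)"
    and trap: "\<And>x0 z0 g z \<delta>. \<delta> \<le> fst (p x0) \<Longrightarrow> holo_curve_on X (ball z0 \<delta>) g \<Longrightarrow>
      (\<forall>z\<in>ball z0 \<delta>. E_length X E g z \<le> C) \<Longrightarrow> dist (g z0) x0 < snd (p x0) \<Longrightarrow> z \<in> ball z0 \<delta> \<Longrightarrow>
      dist (g z) x0 < \<epsilon>/2"
    by blast
  have "UNIV \<subseteq> (\<Union>x\<in>UNIV. ball x (snd (p x)))" using p(2) by auto
  then obtain T where T: "finite T" "UNIV \<subseteq> (\<Union>x\<in>T. ball x (snd (p x)))"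
    using compactE_image[OF cpt, of UNIV "\<lambda>x. ball x (snd (p x))"] by auto
  then have "T \<noteq> {}" by auto
  show thesis
  proof (rule that[of "Min ((fst \<circ> p) ` T)"])
    show "0 < Min ((fst \<circ> p) ` T)" using T \<open>T \<noteq> {}\<close> p by simp
    fix z0 g z \<delta>
    assume \<delta>: "\<delta> \<le> Min ((fst \<circ> p) ` T)" and g: "holo_curve_on X (ball z0 \<delta>) g"
      and C: "\<forall>z\<in>ball z0 \<delta>. E_length X E g z \<le> C" and z: "z \<in> ball z0 \<delta>"
    obtain x where x: "x \<in> T" "g z0 \<in> ball x (snd (p x))" using T(2) by blast
    have "Min ((fst \<circ> p) ` T) \<le> (fst \<circ> p) x" using T(1) x(1) by (intro Min_le) auto
    with \<delta> have \<delta>x: "\<delta> \<le> fst (p x)" by simp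
    have gz0: "dist (g z0) x < snd (p x)" using x by (simp add: dist_commute)
    \<comment> \<open>Then \<open>z0\<close> belongs to the disc, and the trap also bounds
      \<open>g z0\<close>.\<close>
    have "0 < \<delta>" using z by (metis ball_empty empty_iff not_le)
    then have "dist (g z) x < \<epsilon>/2" "dist (g z0) x < \<epsilon>/2"
      using trap[OF \<delta>x g C gz0] z by auto
    then show "dist (g z) (g z0) < \<epsilon>"
      using dist_triangle_half_l by blast
  qed
qed

text \<open>Montel's theorem with bounds that are local and hold for late indices. Besides uniform
  convergence on compact sets it records \<open>curves_converge\<close>, the form in which
  Weierstrass and Hurwitz are applied.\<close>

lemma montel_subsequence:
  assumes D: "open D"
    and loc: "\<And>z. z \<in> D \<Longrightarrow> \<exists>\<rho>>0. \<exists>C. ball z \<rho> \<subseteq> D \<and> (\<forall>\<^sub>F j in sequentially.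
      holo_curve_on X (ball z \<rho>) (g j) \<and> (\<forall>w\<in>ball z \<rho>. E_length X E (g j) w \<le> C))"
  obtains r h where "strict_mono r"
    "\<And>K. compact K \<Longrightarrow> K \<subseteq> D \<Longrightarrow> uniform_limit K (g \<circ> r) h sequentially"
    "curves_converge D (g \<circ> r) h"
proof -
  have "\<exists>\<delta>>0. \<forall>\<^sub>F j in sequentially. \<forall>w\<in>ball z \<delta>. dist (g j w) (g j z) < \<epsilon>"
    if z: "z \<in> D" and "0 < \<epsilon>" for z \<epsilon>
  proof -
    obtain \<rho> C where \<rho>: "\<rho> > 0" and ev: "\<forall>\<^sub>F j in sequentially.
        holo_curve_on X (ball z \<rho>) (g j) \<and> (\<forall>w\<in>ball z \<rho>. E_length X E (g j) w \<le> C)"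
      using loc[OF z] by blast
    obtain \<delta>0 where \<delta>0: "0 < \<delta>0" and equi: "\<And>z0 g z \<delta>. \<lbrakk>\<delta> \<le> \<delta>0; holo_curve_on X (ball z0 \<delta>) g;
        \<forall>z\<in>ball z0 \<delta>. E_length X E g z \<le> C; z \<in> ball z0 \<delta>\<rbrakk> \<Longrightarrow> dist (g z) (g z0) < \<epsilon>"
      using curves_equicontinuous[OF \<open>0 < \<epsilon>\<close>, of C] by blast
    have "\<forall>\<^sub>F j in sequentially. \<forall>w\<in>ball z (min \<delta>0 \<rho>). dist (g j w) (g j z) < \<epsilon>"
      using ev
    proof eventually_elim
      case (elim j)
      have "holo_curve_on X (ball z (min \<delta>0 \<rho>)) (g j)"
        by (rule holo_curve_on_subset[of X "ball z \<rho>"]) (use elim in auto)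
      then show ?case
        using elim equi[of "min \<delta>0 \<rho>" z "g j"] by auto
    qed
    then show ?thesis using \<delta>0 \<rho> by (intro exI[of _ "min \<delta>0 \<rho>"]) auto
  qed
  then obtain r h where r: "strict_mono r"
    and lim: "\<And>K. compact K \<Longrightarrow> K \<subseteq> D \<Longrightarrow> uniform_limit K (g \<circ> r) h sequentially"
    using arzela_ascoli_subsequence[OF cpt D, of g] by blast
  have "curves_converge D (g \<circ> r) h"
    unfolding curves_converge_def
  proof
    fix z assume z: "z \<in> D"
    obtain \<rho> C where \<rho>: "\<rho> > 0" "ball z \<rho> \<subseteq> D" and "\<forall>\<^sub>F j in sequentially.
        holo_curve_on X (ball z \<rho>) (g j) \<and> (\<forall>w\<in>ball z \<rho>. E_length X E (g j) w \<le> C)"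
      using loc[OF z] by blast
    then have "\<forall>\<^sub>F j in sequentially. holo_curve_on X (ball z \<rho>) (g j)"
      by (simp add: eventually_conj_iff)
    then have ev: "\<forall>\<^sub>F j in sequentially. holo_curve_on X (ball z \<rho>) ((g \<circ> r) j)"
      using eventually_subseq[OF r] by (simp add: o_def)
    \<comment> \<open>With half the radius the closed disc is a compact subset of \<open>D\<close>,
      as uniform convergence requires.\<close>
    have sub: "ball z (\<rho>/2) \<subseteq> ball z \<rho>" "cball z (\<rho>/2) \<subseteq> ball z \<rho>" using \<rho> by auto
    have "\<forall>\<^sub>F j in sequentially. holo_curve_on X (ball z (\<rho>/2)) ((g \<circ> r) j)"
      using ev by eventually_elim (use sub(1) holo_curve_on_subset in blast)
    moreover have "uniform_limit (ball z (\<rho>/2)) (g \<circ> r) h sequentially"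
      by (rule uniform_limit_on_subset[OF lim[of "cball z (\<rho>/2)"]]) (use \<rho> sub in auto)
    ultimately show "\<exists>r'>0. ball z r' \<subseteq> D \<and>
       (\<forall>\<^sub>F j in sequentially. holo_curve_on X (ball z r') ((g \<circ> r) j)) \<and>
       uniform_limit (ball z r') (g \<circ> r) h sequentially"
      using \<rho> sub by (intro exI[of _ "\<rho>/2"]) auto
  qed
  with r lim show thesis by (rule that)
qed

text \<open>The local equation of \<open>S\<close> is replaced by a holomorphic function
  \<open>G\<close> on an open set of the ambient space, so that its composition with a curve is
  covered by the chain rule.\<close>

lemma hypersurface_local_equation:
  assumes S: "complex_hypersurface X S" and x: "x \<in> S"
  obtains c W V G where "c \<in> X" "open W" "x \<in> W" "W \<subseteq> cdom c" "holo_on G V" "crd c ` W \<subseteq> V"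
    "\<And>y. y \<in> W \<Longrightarrow> y \<in> S \<longleftrightarrow> G (crd c y) = 0"
proof -
  obtain U \<phi> where U: "open U" "x \<in> U" "holo_fun X U \<phi>" "U \<inter> S = {w\<in>U. \<phi> w = 0}"
    using S x unfolding complex_hypersurface_def by blast
  obtain c where c: "c \<in> X" "x \<in> cdom c" by (rule chart_exists)
  have "sub_holo (crd c ` (cdom c \<inter> U)) (\<lambda>z. \<phi> (cinv c z))"
    using U(3) c(1) unfolding holo_fun_def by blast
  then obtain V G where V: "open V" "crd c x \<in> V" "holo_on G V"
    and G: "\<forall>w\<in>V \<inter> crd c ` (cdom c \<inter> U). G w = \<phi> (cinv c w)"
    unfolding sub_holo_def using c U(2) by blast
  define W where "W = (cdom c \<inter> crd c -` V) \<inter> U"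
  have "open (cdom c \<inter> crd c -` V)"
    using chart_continuous[OF c(1)] chart_open[OF c(1)] V(1) by (rule continuous_open_preimage)
  then have W: "open W" "x \<in> W" "W \<subseteq> cdom c" "crd c ` W \<subseteq> V"
    using U V c by (auto simp: W_def)
  have "y \<in> S \<longleftrightarrow> G (crd c y) = 0" if "y \<in> W" for y
  proof -
    have y: "y \<in> cdom c" "y \<in> U" "crd c y \<in> V" using that by (auto simp: W_def)
    then have "G (crd c y) = \<phi> y" using G cinv_crd[OF c(1)] by (metis IntI imageI)
    then show ?thesis using U(4) y by auto
  qed
  with c(1) W V(3) show thesis by (intro that[of c W G V])
qed

lemma curve_comp_holomorphic:
  assumes g: "holo_curve_on X D g" and c: "c \<in> X" and G: "holo_on G V"
    and B: "open B" "B \<subseteq> D" "\<And>\<zeta>. \<zeta> \<in> B \<Longrightarrow> g \<zeta> \<in> cdom c \<and> crd c (g \<zeta>) \<in> V"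
  shows "(\<lambda>\<zeta>. G (crd c (g \<zeta>))) holomorphic_on B"
proof -
  have "((\<lambda>\<zeta>. G (crd c (g \<zeta>))) has_field_derivative
      frechet_derivative G (at (crd c (g z))) (chart_deriv c g z)) (at z)" if "z \<in> B" for z
    by (rule holo_on_comp_curve[where u = "\<lambda>\<zeta>. crd c (g \<zeta>)", OF G])
       (use B that curve_has_derivative[OF g c] in auto)
  then show ?thesis
    using B(1) by (metis holomorphic_on_open)
qed

text \<open>Where \<open>h\<close> meets \<open>S\<close>, the equation of \<open>S\<close> along
  the curves gives zero-free holomorphic functions whose limit has a zero. By Hurwitz that limit is
  constant, hence zero, so \<open>h\<close> stays in \<open>S\<close> nearby. The set where
  \<open>h\<close> meets \<open>S\<close> is thus open, its complement is open as \<open>S\<close>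
  is closed, and \<open>D\<close> is connected.\<close>

lemma hurwitz_dichotomy:
  assumes D: "open D" "connected D" and S: "complex_hypersurface X S"
    and conv: "curves_converge D g h"
    and avoid: "\<And>z. z \<in> D \<Longrightarrow> \<exists>r>0. \<forall>\<^sub>F j in sequentially. \<forall>w\<in>ball z r. g j w \<notin> S"
  shows "(\<forall>z\<in>D. h z \<notin> S) \<or> (\<forall>z\<in>D. h z \<in> S)"
proof -
  have h: "holo_curve_on X D h" by (rule curves_converge_holo[OF D(1) conv])
  have "closed S" using S unfolding complex_hypersurface_def closed_analytic_subset_def by blast
  have 1: "open {z\<in>D. h z \<in> - S}"
    by (rule curve_preimage_open[OF h]) (use \<open>closed S\<close> in auto)
  have 2: "open {z\<in>D. h z \<in> S}"
    unfolding open_contains_ball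
  proof
    fix z assume "z \<in> {z\<in>D. h z \<in> S}"
    then have z: "z \<in> D" "h z \<in> S" by auto
    obtain c W V G where c: "c \<in> X" and W: "open W" "h z \<in> W" "W \<subseteq> cdom c"
      and V: "holo_on G V" "crd c ` W \<subseteq> V" and eqn: "\<And>y. y \<in> W \<Longrightarrow> y \<in> S \<longleftrightarrow> G (crd c y) = 0"
      by (rule hypersurface_local_equation[OF S z(2)]) (rule that; assumption)
    obtain r1 where r1: "r1 > 0" "ball z r1 \<subseteq> D"
      "\<forall>\<^sub>F j in sequentially. holo_curve_on X (ball z r1) (g j)"
      "uniform_limit (ball z r1) g h sequentially"
      using conv z unfolding curves_converge_def by blast
    obtain r2 where r2: "r2 > 0" "\<forall>\<^sub>F j in sequentially. \<forall>w\<in>ball z r2. g j w \<notin> S"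
      using avoid[OF z(1)] by blast
    have cont: "\<forall>\<^sub>F j in sequentially. continuous_on (ball z r1) (g j)"
      using r1(3) unfolding holo_curve_on_def by eventually_elim blast
    obtain s \<epsilon> where s: "s > 0" "cball z s \<subseteq> ball z r1"
      and \<epsilon>: "compact (cball (h z) \<epsilon>)" "cball (h z) \<epsilon> \<subseteq> W"
      and hs: "\<forall>\<zeta>\<in>cball z s. h \<zeta> \<in> cball (h z) \<epsilon>"
      and ev: "\<forall>\<^sub>F j in sequentially. \<forall>\<zeta>\<in>cball z s. g j \<zeta> \<in> cball (h z) \<epsilon>"
      and lim: "uniform_limit (cball z s) g h sequentially"
      by (rule uniform_limit_local[OF r1(1) cont r1(4) W(1,2)])
    define t where "t = min s r2"
    have t: "t > 0" "ball z t \<subseteq> cball z s" "ball z t \<subseteq> ball z r2" "ball z t \<subseteq> ball z r1"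
      using s r2 by (auto simp: t_def)
    have "\<forall>\<^sub>F j in sequentially. holo_curve_on X (ball z r1) (g j) \<and>
        (\<forall>w\<in>ball z r2. g j w \<notin> S) \<and> (\<forall>\<zeta>\<in>cball z s. g j \<zeta> \<in> cball (h z) \<epsilon>)"
      using r1(3) r2(2) ev by eventually_elim blast
    then obtain N where N: "\<And>j. j \<ge> N \<Longrightarrow> holo_curve_on X (ball z r1) (g j)"
      "\<And>j w. j \<ge> N \<Longrightarrow> w \<in> ball z r2 \<Longrightarrow> g j w \<notin> S"
      "\<And>j \<zeta>. j \<ge> N \<Longrightarrow> \<zeta> \<in> cball z s \<Longrightarrow> g j \<zeta> \<in> cball (h z) \<epsilon>"
      unfolding eventually_sequentially by blast
    have contG: "continuous_on (cball (h z) \<epsilon>) (\<lambda>y. G (crd c y))"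
    proof (rule continuous_on_compose2[of V G _ "crd c"])
      show "continuous_on V G"
        using V(1) holo_on_has_derivative[OF V(1)]
        by (metis continuous_at_imp_continuous_on has_derivative_continuous)
      show "continuous_on (cball (h z) \<epsilon>) (crd c)"
        by (rule continuous_on_subset[OF chart_continuous[OF c]]) (use W \<epsilon> in blast)
    qed (use V \<epsilon> in blast)
    \<comment> \<open>The shift by \<open>N\<close> drops the early curves, since Hurwitz' theorem
      asks for holomorphic zero-free functions at every index.\<close>
    let ?F = "\<lambda>n \<zeta>. G (crd c (g (n + N) \<zeta>))" and ?h = "\<lambda>\<zeta>. G (crd c (h \<zeta>))"
    have "uniform_limit (cball z s) (\<lambda>j \<zeta>. G (crd c (g j \<zeta>))) ?h sequentially"
      by (rule uniform_limit_compose_uniformly_continuous_on[OF lim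
            compact_uniformly_continuous[OF contG \<epsilon>(1)] ev]) simp
    then have ul: "uniform_limit (cball z s) ?F ?h sequentially"
      by (rule filterlim_compose[OF _ filterlim_add_const_nat_at_top])
    have gW: "g (n + N) \<zeta> \<in> W" if "\<zeta> \<in> ball z t" for n \<zeta>
      by (rule subsetD[OF \<epsilon>(2) N(3)[OF le_add2 subsetD[OF t(2) that]]])
    \<comment> \<open>A non-constant limit would be zero-free, against
      \<open>h z \<in> S\<close>.\<close>
    have "?h constant_on ball z t"
    proof (rule ccontr)
      assume nc: "\<not> ?h constant_on ball z t"
      have "?h z \<noteq> 0"
      proof (rule Hurwitz_no_zeros[of "ball z t" ?F ?h])
        show "?F n holomorphic_on ball z t" for n
        proof (rule curve_comp_holomorphic[OF N(1)[of "n + N"] c V(1) open_ball t(4)])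
          fix \<zeta> assume "\<zeta> \<in> ball z t"
          then have "g (n + N) \<zeta> \<in> W" by (rule gW)
          then show "g (n + N) \<zeta> \<in> cdom c \<and> crd c (g (n + N) \<zeta>) \<in> V" using W V by blast
        qed simp
        show "?h holomorphic_on ball z t"
        proof (rule curve_comp_holomorphic[OF h c V(1) open_ball])
          fix \<zeta> assume "\<zeta> \<in> ball z t"
          then have "h \<zeta> \<in> W" using hs t(2) \<epsilon>(2) by blast
          then show "h \<zeta> \<in> cdom c \<and> crd c (h \<zeta>) \<in> V" using W V by blast
        qed (use t r1 in blast)
        show "uniform_limit K ?F ?h sequentially" if "compact K" "K \<subseteq> ball z t" for K
          by (rule uniform_limit_on_subset[OF ul]) (use that t in blast)
        show "?F n \<zeta> \<noteq> 0" if "\<zeta> \<in> ball z t" for n \<zeta>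
        proof -
          have "g (n + N) \<zeta> \<in> W" using that by (rule gW)
          moreover have "g (n + N) \<zeta> \<notin> S"
            using N(2)[of "n + N" \<zeta>] subsetD[OF t(3) that] by simp
          ultimately show ?thesis using eqn by blast
        qed
      qed (use nc t in auto)
      then show False using eqn[OF W(2)] z(2) by simp
    qed
    then have "?h \<zeta> = ?h z" if "\<zeta> \<in> ball z t" for \<zeta>
      using that t(1) unfolding constant_on_def by (metis centre_in_ball)
    then have 0: "?h \<zeta> = 0" if "\<zeta> \<in> ball z t" for \<zeta>
      using that eqn[OF W(2)] z(2) by simp
    have "ball z t \<subseteq> {z\<in>D. h z \<in> S}"
    proof
      fix \<zeta> assume \<zeta>: "\<zeta> \<in> ball z t"
      then have "h \<zeta> \<in> W" using hs t(2) \<epsilon>(2) by blast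
      then have "h \<zeta> \<in> S" using eqn 0[OF \<zeta>] by blast
      then show "\<zeta> \<in> {z\<in>D. h z \<in> S}" using \<zeta> t r1 by blast
    qed
    then show "\<exists>e>0. ball z e \<subseteq> {z\<in>D. h z \<in> S}" using t(1) by blast
  qed
  have "{z\<in>D. h z \<in> - S} \<inter> D = {} \<or> {z\<in>D. h z \<in> S} \<inter> D = {}"
    by (rule connectedD[OF D(2) 1 2]) auto
  then show ?thesis by blast
qed

end

section \<open>Zalcman rescaling\<close>

context compact_hermitian_space
begin

section \<open>Compact divergence through approach to a closed set\<close>

lemma compact_separated:
  fixes S L :: "'x set"
  assumes "closed S" "compact L" "S \<inter> L = {}"
  shows "\<exists>d>0. \<forall>x\<in>S. \<forall>y\<in>L. d \<le> dist x y"
proof (cases "S \<times> L = {}")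
  case True
  then show ?thesis by (auto intro: exI[of _ 1])
next
  case False
  have "compact (S \<times> L)" using assms closed_compact by (intro compact_Times) auto
  moreover have "continuous_on (S \<times> L) (\<lambda>p. dist (fst p) (snd p))"
    by (intro continuous_intros)
  ultimately obtain p where p: "p \<in> S \<times> L" "\<forall>q\<in>S \<times> L. dist (fst p) (snd p) \<le> dist (fst q) (snd q)"
    using continuous_attains_inf[OF _ False, of "\<lambda>p. dist (fst p) (snd p)"] by blast
  have "dist (fst p) (snd p) > 0" using p(1) assms(3) by auto
  moreover have "dist (fst p) (snd p) \<le> dist x y" if "x \<in> S" "y \<in> L" for x y
    using bspec[OF p(2), of "(x, y)"] that by simp
  ultimately show ?thesis by blast
qed

text \<open>A compact subset of the complement has a positive distance from \<open>S\<close>, so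
  points closer to \<open>S\<close> than that distance miss it.\<close>

lemma compactly_divergentI:
  fixes S :: "'x set"
  assumes S: "closed S"
    and near: "\<And>K d. compact K \<Longrightarrow> 0 < d \<Longrightarrow>
      \<forall>\<^sub>F j in sequentially. K \<subseteq> Dm j \<and> (\<forall>\<xi>\<in>K. \<exists>x\<in>S. dist (g j \<xi>) x < d)"
  shows "compactly_divergent (UNIV - S) Dm g"
  unfolding compactly_divergent_def
proof (intro allI impI)
  fix K :: "complex set" and L :: "'x set"
  assume K: "compact K" and L: "compact L" "L \<subseteq> UNIV - S"
  have disj: "S \<inter> L = {}" using L(2) by auto
  obtain d where d: "d > 0" "\<forall>x\<in>S. \<forall>y\<in>L. d \<le> dist x y"
    using compact_separated[OF S L(1) disj] by blast
  have "\<forall>\<^sub>F j in sequentially. K \<subseteq> Dm j \<and> g j ` K \<inter> L = {}"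
  proof (rule eventually_mono[OF near[OF K d(1)]])
    fix j
    assume j: "K \<subseteq> Dm j \<and> (\<forall>\<xi>\<in>K. \<exists>x\<in>S. dist (g j \<xi>) x < d)"
    have "g j \<xi> \<notin> L" if \<xi>: "\<xi> \<in> K" for \<xi>
    proof
      assume gL: "g j \<xi> \<in> L"
      obtain x where x: "x \<in> S" "dist (g j \<xi>) x < d" using j \<xi> by blast
      have "d \<le> dist x (g j \<xi>)" using d(2) x(1) gL by blast
      then show False using x(2) by (simp add: dist_commute)
    qed
    with conjunct1[OF j] show "K \<subseteq> Dm j \<and> g j ` K \<inter> L = {}" by blast
  qed
  then show "\<exists>j0. \<forall>j\<ge>j0. K \<subseteq> Dm j \<and> g j ` K \<inter> L = {}"
    by (simp add: eventually_sequentially)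
qed

lemma E_length_nonneg:
  assumes "holo_curve_on X D g" "z \<in> D"
  shows "0 \<le> E_length X E g z"
proof -
  obtain c where c: "c \<in> X" "g z \<in> cdom c" by (rule chart_exists)
  obtain a where "a > 0" "\<And>x v. x \<in> {g z} \<Longrightarrow> a * norm v \<le> sqrt (Re (herm_form (E c (crd c x)) v v))"
    using chart_comparable[OF c(1), of "{g z}"] c(2) by auto
  then have "0 \<le> chart_length E c g z"
    unfolding chart_length_def by (meson insertI1 mult_nonneg_nonneg norm_ge_zero order_less_imp_le order_trans)
  then show ?thesis using E_length_chart[OF assms c] by simp
qed

lemma E_length_const: "E_length X E (\<lambda>_. x) z = 0"
  by (simp add: E_length_def herm_form_def Let_def)

section \<open>Affine changes of variable and the choice of centres and radii\<close>

lemma holo_curve_affine: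
  assumes f: "holo_curve_on X D f"
  shows "holo_curve_on X {\<xi>. p + of_real \<rho> * \<xi> \<in> D} (\<lambda>\<xi>. f (p + of_real \<rho> * \<xi>))"
proof -
  let ?a = "\<lambda>\<xi>. p + of_real \<rho> * \<xi> :: complex"
  have D: "open D" "continuous_on D f" using f unfolding holo_curve_on_def by auto
  have "open (?a -` D)"
    by (intro open_vimage D continuous_intros)
  moreover have "continuous_on (?a -` D) (\<lambda>\<xi>. f (?a \<xi>))"
    by (rule continuous_on_compose2[OF D(2)]) (auto intro!: continuous_intros)
  moreover have "(\<lambda>\<xi>. crd c (f (?a \<xi>)) $ i) holomorphic_on {\<xi> \<in> ?a -` D. f (?a \<xi>) \<in> cdom c}"
    if "c \<in> X" for c i
  proof -
    have "(\<lambda>z. crd c (f z) $ i) holomorphic_on {z\<in>D. f z \<in> cdom c}"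
      using f that unfolding holo_curve_on_def by blast
    moreover have "?a holomorphic_on {\<xi> \<in> ?a -` D. f (?a \<xi>) \<in> cdom c}"
      by (intro holomorphic_intros)
    ultimately show ?thesis
      using holomorphic_on_compose_gen[of ?a _ "\<lambda>z. crd c (f z) $ i"] unfolding o_def by blast
  qed
  ultimately show ?thesis
    unfolding holo_curve_on_def vimage_def by auto
qed

lemma E_length_affine:
  assumes f: "holo_curve_on X D f" and \<rho>: "0 < \<rho>" and z: "p + of_real \<rho> * \<xi> \<in> D"
  shows "E_length X E (\<lambda>\<xi>. f (p + of_real \<rho> * \<xi>)) \<xi> = \<rho> * E_length X E f (p + of_real \<rho> * \<xi>)"
proof -
  let ?a = "\<lambda>\<xi>. p + of_real \<rho> * \<xi> :: complex"
  obtain c where c: "c \<in> X" "f (?a \<xi>) \<in> cdom c" by (rule chart_exists)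
  have "chart_deriv c (\<lambda>\<xi>. f (?a \<xi>)) \<xi> = \<rho> *\<^sub>R chart_deriv c f (?a \<xi>)"
    unfolding vec_eq_iff
  proof
    fix i
    have "(?a has_field_derivative of_real \<rho>) (at \<xi>)"
      by (auto intro!: derivative_eq_intros)
    then have "((\<lambda>\<xi>. crd c (f (?a \<xi>)) $ i) has_field_derivative
        chart_deriv c f (?a \<xi>) $ i * of_real \<rho>) (at \<xi>)"
      by (rule DERIV_chain2[of "\<lambda>\<zeta>. crd c (f \<zeta>) $ i" _ ?a, OF curve_has_derivative[OF f c(1) z c(2)]])
    then show "chart_deriv c (\<lambda>\<xi>. f (?a \<xi>)) \<xi> $ i = (\<rho> *\<^sub>R chart_deriv c f (?a \<xi>)) $ i"
      by (simp add: chart_deriv_def DERIV_imp_deriv scaleR_conv_of_real[where 'a = complex] mult.commute)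
  qed
  then have "chart_length E c (\<lambda>\<xi>. f (?a \<xi>)) \<xi> = \<rho> * chart_length E c f (?a \<xi>)"
    using \<rho> by (simp add: chart_length_def herm_form_scaleR real_sqrt_mult)
  then show ?thesis
    using E_length_chart[OF f z c] E_length_chart[OF holo_curve_affine[OF f], of \<xi> p \<rho> c] z c by simp
qed

text \<open>The points \<open>q\<close> maximise \<open>(r - dist p z) * E_length X E f z\<close>, as in Zalcman's lemma.\<close>

lemma zalcman_point:
  assumes f: "holo_curve_on X D f" and r: "0 < r" "cball p r \<subseteq> D"
    and w: "w \<in> cball p (r/2)" "2 * C / r < E_length X E f w" and C: "0 < C"
  obtains q \<rho> where "q \<in> ball p r" "0 < \<rho>" "\<rho> * C < r" "E_length X E f q = 1 / \<rho>"
    "\<And>\<xi>. \<xi> \<in> ball 0 (C/2) \<Longrightarrow> q + of_real \<rho> * \<xi> \<in> ball p r \<and> E_length X E f (q + of_real \<rho> * \<xi>) \<le> 2 / \<rho>"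
proof -
  let ?L = "E_length X E f"
  define \<phi> where "\<phi> = (\<lambda>z. (r - dist p z) * ?L z)"
  have "continuous_on (cball p r) \<phi>"
    unfolding \<phi>_def by (intro continuous_intros continuous_on_subset[OF E_length_continuous[OF f] r(2)])
  then obtain q where q: "q \<in> cball p r" "\<And>z. z \<in> cball p r \<Longrightarrow> \<phi> z \<le> \<phi> q"
    using continuous_attains_sup[of "cball p r" \<phi>] r(1) by force
  \<comment> \<open>At \<open>w\<close> the weight \<open>r - dist p w\<close> is at least
    \<open>r/2\<close>, so the threshold \<open>2 * C / r\<close> pushes the maximum of
    \<open>\<phi>\<close> above \<open>C\<close>.\<close>
  have "C = (r/2) * (2 * C / r)" using r by simp
  also have "\<dots> < (r/2) * ?L w" using w(2) r(1) by (intro mult_strict_left_mono) auto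
  also have "\<dots> \<le> \<phi> w"
    unfolding \<phi>_def
  proof (rule mult_right_mono)
    show "r/2 \<le> r - dist p w" using w(1) by simp
    have "0 < 2 * C / r" using C r by simp
    then show "0 \<le> ?L w" using w(2) by linarith
  qed
  also have "\<dots> \<le> \<phi> q" using q(2)[of w] w(1) r(1) by auto
  finally have M: "C < \<phi> q" .
  \<comment> \<open>\<open>t\<close> is the weight at \<open>q\<close>. Since
    \<open>\<rho> * C < t\<close>, rescaling carries the disc of radius \<open>C/2\<close> into the
    disc of radius \<open>t/2\<close> about \<open>q\<close>. There the weight is at least
    \<open>t/2\<close>, so maximality at \<open>q\<close> bounds the length by twice its value at
    \<open>q\<close>.\<close>
  define t where "t = r - dist p q"
  have t: "t * ?L q > C" "t \<ge> 0" using M q(1) by (auto simp: \<phi>_def t_def)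
  then have "t > 0" using C by (cases "t = 0") auto
  then have L: "?L q > 0" using t C by (smt (verit) mult_nonneg_nonpos)
  \<comment> \<open>With this scale the rescaled curve has length one at the origin.\<close>
  define \<rho> where "\<rho> = 1 / ?L q"
  have \<rho>: "\<rho> > 0" "\<rho> * C < t" "?L q = 1 / \<rho>"
    using L t by (auto simp: \<rho>_def field_simps)
  have tr: "t \<le> r" by (simp add: t_def)
  show thesis
  proof (rule that[of q \<rho>])
    show "q \<in> ball p r" using \<open>t > 0\<close> by (simp add: t_def)
    show "\<rho> * C < r" using \<rho> tr by simp
    fix \<xi> :: complex assume \<xi>: "\<xi> \<in> ball 0 (C/2)"
    let ?z = "q + of_real \<rho> * \<xi>"
    have "dist q ?z = \<rho> * norm \<xi>" using \<rho>(1) by (simp add: dist_norm norm_mult)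
    also have "\<dots> \<le> \<rho> * (C/2)" using \<xi> \<rho>(1) by (intro mult_left_mono) auto
    also have "\<dots> < t/2" using \<rho>(2) by simp
    finally have "dist q ?z < t/2" .
    then have z: "t/2 \<le> r - dist p ?z" using dist_triangle[of p ?z q] by (simp add: t_def)
    then have z': "?z \<in> ball p r" using \<open>t > 0\<close> by simp
    then have "?z \<in> D" using r(2) by auto
    then have "(t/2) * ?L ?z \<le> \<phi> ?z"
      unfolding \<phi>_def using z E_length_nonneg[OF f] by (intro mult_right_mono) auto
    also have "\<dots> \<le> \<phi> q" using q(2)[of ?z] z' by auto
    also have "\<dots> = t * (1 / \<rho>)" using \<rho>(3) by (simp add: \<phi>_def t_def)
    finally have "?L ?z \<le> 2 / \<rho>" using \<open>t > 0\<close> \<rho>(1) by (simp add: field_simps)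
    then show "?z \<in> ball p r \<and> ?L ?z \<le> 2 / \<rho>" using z' by blast
  qed (use \<rho> in auto)
qed

text \<open>The rescaled curves have length at most 2 on discs exhausting the plane, so Montel
  applies. Their length 1 at the origin survives in the limit and is what excludes a constant
  limit.\<close>

lemma zalcman_rescaling:
  assumes D: "open D" and F: "\<And>f. f \<in> F \<Longrightarrow> holo_curve_on X D f" and p: "p \<in> D"
    and unbdd: "\<And>r C. 0 < r \<Longrightarrow> cball p r \<subseteq> D \<Longrightarrow> \<exists>f\<in>F. \<exists>z\<in>cball p r. C < E_length X E f z"
  obtains q q0 f \<rho> h where "\<And>j::nat. q j \<in> D" "q0 \<in> D" "q \<longlonglongrightarrow> q0" "\<And>j. f j \<in> F"
    "\<And>j. 0 < \<rho> j" "\<rho> \<longlonglongrightarrow> 0"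
    "\<And>K. compact K \<Longrightarrow> \<forall>\<^sub>F j in sequentially. K \<subseteq> {\<xi>. q j + of_real (\<rho> j) * \<xi> \<in> D}"
    "\<And>K. compact K \<Longrightarrow> uniform_limit K (\<lambda>j \<xi>. f j (q j + of_real (\<rho> j) * \<xi>)) h sequentially"
    "curves_converge UNIV (\<lambda>j \<xi>. f j (q j + of_real (\<rho> j) * \<xi>)) h"
    "\<And>z. E_length X E h z \<le> 2" "E_length X E h 0 = 1"
proof -
  obtain r where r: "0 < r" "cball p r \<subseteq> D"
    using D p open_contains_cball by blast
  \<comment> \<open>Large lengths are sought in the half disc, where the weight of
    \<open>zalcman_point\<close> is at least \<open>r/2\<close>.\<close>
  have half: "0 < r/2" "cball p (r/2) \<subseteq> D" using r by auto
  \<comment> \<open>As \<open>C j\<close> grows, the discs of radius \<open>C j/2\<close> exhaust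
    the plane, and \<open>\<rho> j * C j < r\<close> forces the scales to zero. Adding 1 makes
    \<open>C 0\<close> positive.\<close>
  define C where "C = (\<lambda>j::nat. real j + 1)"
  \<comment> \<open>The triple of curve, centre and scale is packed into one object so that a single
    choice over \<open>j\<close> selects all three.\<close>
  define P where "P = (\<lambda>j t. fst t \<in> F \<and> fst (snd t) \<in> ball p r \<and> 0 < snd (snd t) \<and>
    snd (snd t) * C j < r \<and> E_length X E (fst t) (fst (snd t)) = 1 / snd (snd t) \<and>
    (\<forall>\<xi>\<in>ball 0 (C j/2). fst (snd t) + of_real (snd (snd t)) * \<xi> \<in> ball p r \<and>
      E_length X E (fst t) (fst (snd t) + of_real (snd (snd t)) * \<xi>) \<le> 2 / snd (snd t)))"
  have "\<forall>j. \<exists>t. P j t"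
  proof
    fix j
    obtain f w where f: "f \<in> F" and w: "w \<in> cball p (r/2)" "2 * C j / r < E_length X E f w"
      using unbdd[OF half] by blast
    have "0 < C j" by (simp add: C_def)
    then obtain q \<rho> where "q \<in> ball p r" "0 < \<rho>" "\<rho> * C j < r" "E_length X E f q = 1 / \<rho>"
      "\<And>\<xi>. \<xi> \<in> ball 0 (C j/2) \<Longrightarrow>
        q + of_real \<rho> * \<xi> \<in> ball p r \<and> E_length X E f (q + of_real \<rho> * \<xi>) \<le> 2 / \<rho>"
      by (rule zalcman_point[OF F[OF f] r w]) (rule that; assumption)
    then show "\<exists>t. P j t" using f by (intro exI[of _ "(f, q, \<rho>)"]) (simp add: P_def)
  qed
  from choice[OF this] obtain T where T: "\<And>j. P j (T j)" by blast
  define f q \<rho> where "f = fst \<circ> T" and "q = fst \<circ> snd \<circ> T" and "\<rho> = snd \<circ> snd \<circ> T"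
  have f: "f j \<in> F" and q: "q j \<in> ball p r" and \<rho>: "0 < \<rho> j" "\<rho> j * C j < r"
    and one: "E_length X E (f j) (q j) = 1 / \<rho> j"
    and two: "\<xi> \<in> ball 0 (C j/2) \<Longrightarrow> q j + of_real (\<rho> j) * \<xi> \<in> ball p r \<and>
      E_length X E (f j) (q j + of_real (\<rho> j) * \<xi>) \<le> 2 / \<rho> j" for j \<xi>
    using T[of j] by (auto simp: P_def f_def q_def \<rho>_def)
  define G where "G = (\<lambda>j \<xi>. f j (q j + of_real (\<rho> j) * \<xi>))"
  have inD: "q j + of_real (\<rho> j) * \<xi> \<in> D" if "\<xi> \<in> ball 0 (C j/2)" for j \<xi>
    using two[OF that] r(2) by auto
  have G: "holo_curve_on X (ball 0 (C j/2)) (G j)" for j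
    unfolding G_def
    by (rule holo_curve_on_subset[OF holo_curve_affine[OF F[OF f[of j]]]]) (use inD in auto)
  have G2: "E_length X E (G j) \<xi> \<le> 2" if "\<xi> \<in> ball 0 (C j/2)" for j \<xi>
    using two[OF that] \<rho>(1)[of j] E_length_affine[OF F[OF f[of j]] \<rho>(1)[of j] inD[OF that]]
    by (simp add: G_def field_simps)
  have G1: "E_length X E (G j) 0 = 1" for j
  proof -
    have "(0::complex) \<in> ball 0 (C j/2)" by (simp add: C_def)
    then show ?thesis
      using one[of j] \<rho>(1)[of j] E_length_affine[OF F[OF f[of j]] \<rho>(1)[of j] inD, of 0]
      by (simp add: G_def)
  qed
  have big: "\<forall>\<^sub>F j in sequentially. K \<subseteq> ball 0 (C j/2)" if "bounded K" for K :: "complex set"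
  proof -
    obtain B where B: "\<And>x. x \<in> K \<Longrightarrow> norm x \<le> B" using \<open>bounded K\<close> bounded_iff by blast
    obtain N :: nat where N: "2 * B < real N" using reals_Archimedean2 by blast
    show ?thesis unfolding eventually_sequentially
    proof (intro exI[of _ N] allI impI subsetI)
      fix j x assume "N \<le> j" "x \<in> K"
      then have "norm x \<le> B" "real N \<le> real j" using B by auto
      then show "x \<in> ball 0 (C j/2)" using N by (simp add: C_def)
    qed
  qed
  have "compact (cball p r)" by simp
  \<comment> \<open>A first subsequence makes the centres converge within the closed disc; Montel
    then passes to a further one, and \<open>\<sigma>\<close> is the composition.\<close>
  then obtain q0 s where s: "q0 \<in> cball p r" "strict_mono s" "(q \<circ> s) \<longlonglongrightarrow> q0"
    using q ball_subset_cball unfolding compact_eq_seq_compact_metric seq_compact_def by (metis subsetD)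
  have "\<exists>\<rho>>0. \<exists>B. ball z \<rho> \<subseteq> UNIV \<and> (\<forall>\<^sub>F j in sequentially.
      holo_curve_on X (ball z \<rho>) ((G \<circ> s) j) \<and> (\<forall>w\<in>ball z \<rho>. E_length X E ((G \<circ> s) j) w \<le> B))" for z
  proof -
    have "\<forall>\<^sub>F j in sequentially. ball z 1 \<subseteq> ball 0 (C (s j)/2)"
      using eventually_subseq[OF s(2) big[of "ball z 1"]] by simp
    then have "\<forall>\<^sub>F j in sequentially.
        holo_curve_on X (ball z 1) ((G \<circ> s) j) \<and> (\<forall>w\<in>ball z 1. E_length X E ((G \<circ> s) j) w \<le> 2)"
    proof eventually_elim
      case (elim j)
      show ?case
        using holo_curve_on_subset[OF G[of "s j"] open_ball elim] G2[of _ "s j"] elim by auto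
    qed
    then show ?thesis by (intro exI[of _ 1] conjI exI[of _ 2]) auto
  qed
  then obtain s' h where s': "strict_mono s'"
    and lim: "\<And>K. compact K \<Longrightarrow> K \<subseteq> UNIV \<Longrightarrow> uniform_limit K (G \<circ> s \<circ> s') h sequentially"
    and conv: "curves_converge UNIV (G \<circ> s \<circ> s') h"
    by (rule montel_subsequence[OF open_UNIV, of "G \<circ> s"]) (rule that; assumption)
  define \<sigma> where "\<sigma> = s \<circ> s'"
  have \<sigma>: "strict_mono \<sigma>" using s s' by (simp add: \<sigma>_def strict_mono_o)
  have G\<sigma>: "G \<circ> s \<circ> s' = (\<lambda>j \<xi>. f (\<sigma> j) (q (\<sigma> j) + of_real (\<rho> (\<sigma> j)) * \<xi>))"
    by (simp add: G_def \<sigma>_def fun_eq_iff)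
  have EL: "(\<lambda>j. E_length X E (G (\<sigma> j)) z) \<longlonglongrightarrow> E_length X E h z" for z
    using curves_converge_E_length[OF open_UNIV conv, of z] by (simp add: \<sigma>_def)
  show thesis
  proof (rule that[of "q \<circ> \<sigma>" q0 "f \<circ> \<sigma>" "\<rho> \<circ> \<sigma>" h])
    show "(q \<circ> \<sigma>) j \<in> D" for j
      by (rule subsetD[OF r(2)]) (use q[of "\<sigma> j"] in auto)
    show "q0 \<in> D" using s r by auto
    show "(q \<circ> \<sigma>) \<longlonglongrightarrow> q0" using LIMSEQ_subseq_LIMSEQ[OF s(3) s'] by (simp add: \<sigma>_def o_assoc)
    show "(f \<circ> \<sigma>) j \<in> F" "0 < (\<rho> \<circ> \<sigma>) j" for j using f \<rho> by auto
    have "\<rho> \<longlonglongrightarrow> 0"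
    proof (rule tendsto_sandwich[of "\<lambda>_. 0" _ _ "\<lambda>j. r / C j"])
      show "\<forall>\<^sub>F j in sequentially. 0 \<le> \<rho> j" 
        by (intro always_eventually allI less_imp_le \<rho>(1))
      show "\<forall>\<^sub>F j in sequentially. \<rho> j \<le> r / C j"
      proof (intro always_eventually allI)
        show "\<rho> j \<le> r / C j" for j
          using \<rho>(2)[of j] by (simp add: C_def pos_le_divide_eq)
      qed
      show "(\<lambda>j. r / C j) \<longlonglongrightarrow> 0"
        unfolding C_def using LIMSEQ_Suc[OF lim_const_over_n[of r]] by (simp add: add.commute)
    qed auto
    then show "(\<rho> \<circ> \<sigma>) \<longlonglongrightarrow> 0" using \<sigma> by (rule LIMSEQ_subseq_LIMSEQ)
    fix K :: "complex set" assume K: "compact K"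
    have "\<forall>\<^sub>F j in sequentially. K \<subseteq> ball 0 (C (\<sigma> j)/2)"
      using eventually_subseq[OF \<sigma> big[OF compact_imp_bounded[OF K]]] .
    then show "\<forall>\<^sub>F j in sequentially. K \<subseteq> {\<xi>. (q \<circ> \<sigma>) j + of_real ((\<rho> \<circ> \<sigma>) j) * \<xi> \<in> D}"
      by eventually_elim (use inD in auto)
    show "uniform_limit K (\<lambda>j \<xi>. (f \<circ> \<sigma>) j ((q \<circ> \<sigma>) j + of_real ((\<rho> \<circ> \<sigma>) j) * \<xi>)) h sequentially"
      using lim[OF K] unfolding G\<sigma> by simp
  next
    show "curves_converge UNIV (\<lambda>j \<xi>. (f \<circ> \<sigma>) j ((q \<circ> \<sigma>) j + of_real ((\<rho> \<circ> \<sigma>) j) * \<xi>)) h"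
      using conv unfolding G\<sigma> by simp
    show "E_length X E h z \<le> 2" for z
    proof (rule tendsto_upperbound[OF EL])
      show "\<forall>\<^sub>F j in sequentially. E_length X E (G (\<sigma> j)) z \<le> 2"
        by (rule eventually_mono[OF eventually_subseq[OF \<sigma> big[of "{z}"]]]) (auto intro: G2)
    qed simp
    show "E_length X E h 0 = 1"
      using EL[of 0] by (simp add: G1 LIMSEQ_const_iff)
  qed
qed

end

section \<open>The compact-open topology\<close>

lemma tendsto_fun_iff:
  fixes l :: "nat \<Rightarrow> 'x::metric_space"
  shows "(a \<longlongrightarrow> l) F \<longleftrightarrow> (\<forall>n. ((\<lambda>j. a j n) \<longlongrightarrow> l n) F)"
proof -
  have "(a \<longlongrightarrow> l) F \<longleftrightarrow>
      limitin (product_topology (\<lambda>_::nat. euclidean :: 'x topology) UNIV) a l F"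
    by (simp add: euclidean_product_topology)
  also have "\<dots> \<longleftrightarrow> (\<forall>n. ((\<lambda>j. a j n) \<longlongrightarrow> l n) F)"
    unfolding limitin_componentwise by simp
  finally show ?thesis .
qed

lemma topspace_compact_open [simp]: "topspace (compact_open_topology X \<Omega> M) = Hol X \<Omega> M"
proof -
  \<comment> \<open>For empty \<open>K\<close> the condition on \<open>f\<close> is vacuous, so all
    of \<open>Hol X \<Omega> M\<close> is a subbasic set.\<close>
  have "Hol X \<Omega> M \<in> {{f \<in> Hol X \<Omega> M. f ` K \<subseteq> U} | K U.
      compact K \<and> K \<subseteq> \<Omega> \<and> openin (top_of_set M) U}"
    by (rule CollectI, rule exI[of _ "{}"], rule exI[of _ "{}"]) auto
  then show ?thesis
    unfolding compact_open_topology_def topology_generated_by_topspace by blast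
qed

lemma openin_compact_open:
  assumes "compact K" "K \<subseteq> \<Omega>" "openin (top_of_set M) U"
  shows "openin (compact_open_topology X \<Omega> M) {f \<in> Hol X \<Omega> M. f ` K \<subseteq> U}"
  unfolding compact_open_topology_def by (rule topology_generated_by_Basis) (use assms in blast)

text \<open>Extensional maps that differ do so at a point of \<open>\<Omega>\<close>, and the
  subbasic sets with \<open>K\<close> that point separate them. This is what later makes a compact
  set of maps closed.\<close>

lemma Hausdorff_compact_open: "Hausdorff_space (compact_open_topology X \<Omega> M)"
  unfolding Hausdorff_space_def topspace_compact_open
proof (intro allI impI, elim conjE)
  fix f g assume f: "f \<in> Hol X \<Omega> M" and g: "g \<in> Hol X \<Omega> M" and ne: "f \<noteq> g"
  have "f \<in> extensional \<Omega>" "g \<in> extensional \<Omega>"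
    using f g unfolding Hol_def PiE_def by auto
  then obtain z where z: "z \<in> \<Omega>" "f z \<noteq> g z"
    using ne extensionalityI by metis
  obtain U V where UV: "open U" "open V" "f z \<in> U" "g z \<in> V" "U \<inter> V = {}"
    using hausdorff[OF z(2)] by blast
  have fz: "f z \<in> M" "g z \<in> M" using f g z unfolding Hol_def by auto
  let ?N = "\<lambda>U. {f \<in> Hol X \<Omega> M. f ` {z} \<subseteq> M \<inter> U}"
  have "openin (compact_open_topology X \<Omega> M) (?N U)" "openin (compact_open_topology X \<Omega> M) (?N V)"
    using z UV by (intro openin_compact_open openin_open_Int; simp)+
  moreover have "f \<in> ?N U" "g \<in> ?N V" using f g fz UV by auto
  moreover have "disjnt (?N U) (?N V)" using UV by (auto simp: disjnt_def)
  ultimately show "\<exists>U V. openin (compact_open_topology X \<Omega> M) U \<and>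
      openin (compact_open_topology X \<Omega> M) V \<and> f \<in> U \<and> g \<in> V \<and> disjnt U V"
    by (intro exI[of _ "?N U"] exI[of _ "?N V"]) simp
qed

text \<open>If each map had a neighbourhood that the sequence eventually avoids, a finite subcover
  of the closure would leave no room for late terms. Visits at arbitrarily late indices to each
  subbasic neighbourhood are enough for what follows, and no countable base at \<open>h\<close> has
  to be found.\<close>

lemma normal_family_cluster:
  assumes norm: "normal_family X \<Omega> M F" and FH: "F \<subseteq> Hol X \<Omega> M" and f: "\<And>j::nat. f j \<in> F"
  shows "\<exists>h\<in>Hol X \<Omega> M. \<forall>K U. compact K \<longrightarrow> K \<subseteq> \<Omega> \<longrightarrow> openin (top_of_set M) U \<longrightarrow> h ` K \<subseteq> U \<longrightarrow>
      (\<forall>N. \<exists>j\<ge>N. f j ` K \<subseteq> U)"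
proof (rule ccontr)
  assume no: "\<not> ?thesis"
  let ?T = "compact_open_topology X \<Omega> M"
  let ?C = "?T closure_of F"
  have "\<forall>h\<in>Hol X \<Omega> M. \<exists>t. openin ?T (fst t) \<and> h \<in> fst t \<and> (\<forall>j\<ge>snd t. f j \<notin> fst t)"
  proof
    fix h assume h: "h \<in> Hol X \<Omega> M"
    have "\<not> (\<forall>K U. compact K \<longrightarrow> K \<subseteq> \<Omega> \<longrightarrow> openin (top_of_set M) U \<longrightarrow> h ` K \<subseteq> U \<longrightarrow>
        (\<forall>N. \<exists>j\<ge>N. f j ` K \<subseteq> U))"
      using no h by (simp only: bex_simps ball_simps) blast
    then obtain K U N where K: "compact K" "K \<subseteq> \<Omega>" "openin (top_of_set M) U" "h ` K \<subseteq> U"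
      and N: "\<forall>j\<ge>N. \<not> f j ` K \<subseteq> U"
      unfolding not_all not_imp not_ex de_Morgan_conj by blast
    then show "\<exists>t. openin ?T (fst t) \<and> h \<in> fst t \<and> (\<forall>j\<ge>snd t. f j \<notin> fst t)"
      using openin_compact_open[OF K(1-3), of X] h
      by (intro exI[of _ "({f \<in> Hol X \<Omega> M. f ` K \<subseteq> U}, N)"]) auto
  qed
  from bchoice[OF this] obtain t where
    t: "\<forall>h\<in>Hol X \<Omega> M. openin ?T (fst (t h)) \<and> h \<in> fst (t h) \<and> (\<forall>j\<ge>snd (t h). f j \<notin> fst (t h))" ..
  have CH: "?C \<subseteq> Hol X \<Omega> M" using closure_of_subset_topspace[of ?T F] by simp
  have "compactin ?T ?C" using norm unfolding normal_family_def .
  then have "\<exists>\<F>. finite \<F> \<and> \<F> \<subseteq> (\<lambda>h. fst (t h)) ` ?C \<and> ?C \<subseteq> \<Union>\<F>"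
    by (rule compactinD) (use t CH in blast)+
  then obtain \<F> where \<F>: "finite \<F>" "\<F> \<subseteq> (\<lambda>h. fst (t h)) ` ?C" "?C \<subseteq> \<Union>\<F>" by blast
  then obtain A where A: "finite A" "A \<subseteq> ?C" "?C \<subseteq> (\<Union>h\<in>A. fst (t h))"
    using finite_subset_image[OF \<F>(1,2)] by blast
  \<comment> \<open>From index \<open>N\<close> on, the sequence avoids all the finitely many
    neighbourhoods, yet \<open>f N\<close> lies in one of them.\<close>
  define N where "N = Max (insert 0 ((\<lambda>h. snd (t h)) ` A))"
  have "F \<subseteq> ?C" by (rule closure_of_subset) (use FH in simp)
  then obtain h where h: "h \<in> A" "f N \<in> fst (t h)" using A(3) f by blast
  have "snd (t h) \<le> N" unfolding N_def using A(1) h(1) by (intro Max_ge) auto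
  then show False using t h A(2) CH by blast
qed

context compact_hermitian_space
begin

section \<open>Curves with prescribed local bounds on the length\<close>

lemma curves_converge_cong:
  assumes "curves_converge D g h" "\<And>z. z \<in> D \<Longrightarrow> h z = h' z"
  shows "curves_converge D g h'"
  unfolding curves_converge_def
proof
  fix z assume "z \<in> D"
  then obtain r where r: "r > 0" "ball z r \<subseteq> D" "\<forall>\<^sub>F j in sequentially. holo_curve_on X (ball z r) (g j)"
    "uniform_limit (ball z r) g h sequentially"
    using assms(1) unfolding curves_converge_def by blast
  have "uniform_limit (ball z r) g h' sequentially"
    using r(4) by (rule iffD1[OF uniform_limit_cong', rotated 2]) (use r(2) assms(2) in auto)
  then show "\<exists>r>0. ball z r \<subseteq> D \<and> (\<forall>\<^sub>F j in sequentially. holo_curve_on X (ball z r) (g j)) \<and>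
      uniform_limit (ball z r) g h' sequentially"
    using r by blast
qed

text \<open>The target is the whole compact space rather than \<open>M\<close>, so that the class
  contains its limits; \<open>R\<close> and \<open>B\<close> fix one disc and one bound at each
  point for all curves alike.\<close>

definition bounded_curves ::
  "complex set \<Rightarrow> (complex \<Rightarrow> real) \<Rightarrow> (complex \<Rightarrow> real) \<Rightarrow> (complex \<Rightarrow> 'x) set" where
  "bounded_curves \<Omega> R B =
    {f \<in> Hol X \<Omega> UNIV. \<forall>p\<in>\<Omega>. \<forall>z\<in>cball p (R p). E_length X E f z \<le> B p}"

text \<open>Sequential compactness of the class: Montel gives the subsequence, and convergence of
  the \<open>E\<close>-lengths puts the limit under the same bounds.\<close>

lemma bounded_curves_subsequence:
  assumes \<Omega>: "open \<Omega>" and R: "\<And>p. p \<in> \<Omega> \<Longrightarrow> 0 < R p \<and> cball p (R p) \<subseteq> \<Omega>"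
    and f: "\<And>j::nat. f j \<in> bounded_curves \<Omega> R B"
  shows "\<exists>r h. strict_mono r \<and> h \<in> bounded_curves \<Omega> R B \<and>
    (\<forall>K. compact K \<longrightarrow> K \<subseteq> \<Omega> \<longrightarrow> uniform_limit K (f \<circ> r) h sequentially) \<and>
    curves_converge \<Omega> (f \<circ> r) h"
proof -
  have holo: "holo_curve_on X \<Omega> (f j)" for j
    using f[of j] by (auto simp: bounded_curves_def Hol_def)
  have bd: "E_length X E (f j) z \<le> B p" if "p \<in> \<Omega>" "z \<in> cball p (R p)" for j p z
    using f[of j] that by (auto simp: bounded_curves_def)
  have loc: "\<exists>\<rho>>0. \<exists>C. ball z \<rho> \<subseteq> \<Omega> \<and> (\<forall>\<^sub>F j in sequentially.
      holo_curve_on X (ball z \<rho>) (f j) \<and> (\<forall>w\<in>ball z \<rho>. E_length X E (f j) w \<le> C))" if z: "z \<in> \<Omega>" for z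
  proof -
    have sub: "ball z (R z) \<subseteq> \<Omega>" using R[OF z] ball_subset_cball by blast
    have "holo_curve_on X (ball z (R z)) (f j) \<and> (\<forall>w\<in>ball z (R z). E_length X E (f j) w \<le> B z)" for j
      using holo_curve_on_subset[OF holo open_ball sub] bd[OF z] ball_subset_cball by blast
    then show ?thesis using R[OF z] sub by (intro exI[of _ "R z"] conjI exI[of _ "B z"]) auto
  qed
  obtain r h where r: "strict_mono r"
    and lim: "\<And>K. compact K \<Longrightarrow> K \<subseteq> \<Omega> \<Longrightarrow> uniform_limit K (f \<circ> r) h sequentially"
    and conv: "curves_converge \<Omega> (f \<circ> r) h"
    by (rule montel_subsequence[OF \<Omega> loc]) (assumption | rule that)+
  \<comment> \<open>Montel fixes the limit only on \<open>\<Omega>\<close>; restricting it yields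
    the extensional map demanded by \<open>Hol\<close>.\<close>
  define h' where "h' = restrict h \<Omega>"
  have eq: "h z = h' z" if "z \<in> \<Omega>" for z using that by (simp add: h'_def)
  have conv': "curves_converge \<Omega> (f \<circ> r) h'"
    using conv eq by (rule curves_converge_cong)
  have lim': "uniform_limit K (f \<circ> r) h' sequentially" if "compact K" "K \<subseteq> \<Omega>" for K
    using lim[OF that] by (rule iffD1[OF uniform_limit_cong', rotated 2]) (use that eq in auto)
  have "E_length X E h' z \<le> B p" if "p \<in> \<Omega>" "z \<in> cball p (R p)" for p z
  proof (rule tendsto_upperbound)
    show "(\<lambda>j. E_length X E ((f \<circ> r) j) z) \<longlonglongrightarrow> E_length X E h' z"
      by (rule curves_converge_E_length[OF \<Omega> conv']) (use R that in blast)
    show "\<forall>\<^sub>F j in sequentially. E_length X E ((f \<circ> r) j) z \<le> B p"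
      using bd[OF that] by simp
  qed simp
  moreover have "h' \<in> Hol X \<Omega> UNIV"
    using curves_converge_holo[OF \<Omega> conv'] by (simp add: Hol_def h'_def PiE_def)
  ultimately have "h' \<in> bounded_curves \<Omega> R B" by (simp add: bounded_curves_def)
  then show ?thesis using r lim' conv' by blast
qed

text \<open>The set where two continuous maps differ is open, so it would contain a sample point.
  This makes evaluation at a dense sequence injective on \<open>Hol\<close>.\<close>

lemma Hol_eq_if_eq_dense:
  assumes f: "f \<in> Hol X \<Omega> UNIV" and g: "g \<in> Hol X \<Omega> UNIV"
    and q: "\<And>U. open U \<Longrightarrow> U \<noteq> {} \<Longrightarrow> U \<subseteq> \<Omega> \<Longrightarrow> \<exists>n. q n \<in> U" and eq: "\<And>n. f (q n) = g (q n)"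
  shows "f = g"
proof -
  have h: "open \<Omega>" "continuous_on \<Omega> f" "continuous_on \<Omega> g"
    using f g unfolding Hol_def holo_curve_on_def by auto
  have "continuous_on \<Omega> (\<lambda>z. dist (f z) (g z))" by (intro continuous_intros h)
  then have "open (\<Omega> \<inter> (\<lambda>z. dist (f z) (g z)) -` {0<..})"
    using h(1) by (intro continuous_open_preimage) auto
  then have "\<Omega> \<inter> (\<lambda>z. dist (f z) (g z)) -` {0<..} = {}"
    using q[of "\<Omega> \<inter> (\<lambda>z. dist (f z) (g z)) -` {0<..}"] eq by auto
  then have "f z = g z" if "z \<in> \<Omega>" for z
    using that by (metis (mono_tags, lifting) IntI disjoint_iff greaterThan_iff vimageI zero_less_dist_iff)
  moreover have "f \<in> extensional \<Omega>" "g \<in> extensional \<Omega>"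
    using f g unfolding Hol_def PiE_def by auto
  ultimately show ?thesis by (rule_tac extensionalityI)
qed

text \<open>Evaluation at a dense sequence embeds \<open>bounded_curves \<Omega> R B\<close> into the compact metric space
  of sequences in \<open>'x\<close>. Compactness there is sequential compactness, and the inverse of
  the embedding is continuous into the compact-open topology.\<close>

lemma normal_familyI:
  assumes \<Omega>: "open \<Omega>" "\<Omega> \<noteq> {}" and FH: "F \<subseteq> Hol X \<Omega> M"
    and bdd: "\<And>p. p \<in> \<Omega> \<Longrightarrow> \<exists>r C. 0 < r \<and> cball p r \<subseteq> \<Omega> \<and> (\<forall>f\<in>F. \<forall>z\<in>cball p r. E_length X E f z \<le> C)"
    and lim: "\<And>f h. (\<And>j::nat. f j \<in> F) \<Longrightarrow>
      (\<forall>K. compact K \<longrightarrow> K \<subseteq> \<Omega> \<longrightarrow> uniform_limit K f h sequentially) \<Longrightarrow>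
      curves_converge \<Omega> f h \<Longrightarrow> \<forall>z\<in>\<Omega>. h z \<in> M"
  shows "normal_family X \<Omega> M F"
proof -
  have "\<forall>p\<in>\<Omega>. \<exists>t. 0 < fst t \<and> cball p (fst t) \<subseteq> \<Omega> \<and> (\<forall>f\<in>F. \<forall>z\<in>cball p (fst t). E_length X E f z \<le> snd t)"
    using bdd by simp
  from bchoice[OF this] obtain t where t: "\<forall>p\<in>\<Omega>. 0 < fst (t p) \<and> cball p (fst (t p)) \<subseteq> \<Omega> \<and>
    (\<forall>f\<in>F. \<forall>z\<in>cball p (fst (t p)). E_length X E f z \<le> snd (t p))" ..
  define R B where "R = fst \<circ> t" and "B = snd \<circ> t"
  let ?G = "bounded_curves \<Omega> R B"
  have R: "0 < R p \<and> cball p (R p) \<subseteq> \<Omega>" if "p \<in> \<Omega>" for p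
    using t that by (simp add: R_def)
  have FG: "F \<subseteq> ?G"
  proof
    fix f assume f: "f \<in> F"
    then have "f \<in> Hol X \<Omega> UNIV" using FH by (auto simp: Hol_def)
    then show "f \<in> ?G" using t f by (simp add: bounded_curves_def R_def B_def)
  qed
  have GH: "?G \<subseteq> Hol X \<Omega> UNIV" by (auto simp: bounded_curves_def)
  note sub = bounded_curves_subsequence[OF \<Omega>(1) R]
  obtain D :: "complex set" where D: "countable D" "\<And>U. open U \<Longrightarrow> U \<noteq> {} \<Longrightarrow> \<exists>y\<in>D. y \<in> U"
    using countable_dense_setE by metis
  have D\<Omega>: "D \<inter> \<Omega> \<noteq> {}" "countable (D \<inter> \<Omega>)" using D \<Omega> by auto
  define q where "q = from_nat_into (D \<inter> \<Omega>)"
  have q: "q n \<in> \<Omega>" for n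
    using from_nat_into[OF D\<Omega>(1)] by (simp add: q_def)
  have dense: "\<exists>n. q n \<in> U" if U: "open U" "U \<noteq> {}" "U \<subseteq> \<Omega>" for U
  proof -
    obtain y where "y \<in> D" "y \<in> U" using D(2)[OF U(1,2)] by blast
    then have "y \<in> D \<inter> \<Omega>" using U by auto
    then obtain n where "q n = y" using from_nat_into_surj[OF D\<Omega>(2)] unfolding q_def by blast
    then show ?thesis using \<open>y \<in> U\<close> by blast
  qed
  define \<Phi> where "\<Phi> = (\<lambda>f :: complex \<Rightarrow> 'x. \<lambda>n. f (q n))"
  have inj: "f = g" if "f \<in> ?G" "g \<in> ?G" "\<Phi> f = \<Phi> g" for f g
    by (rule Hol_eq_if_eq_dense[of f \<Omega> g q])
       (use that GH dense in \<open>auto simp: \<Phi>_def fun_eq_iff\<close>)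
  have \<Phi>_lim: "(\<lambda>j. \<Phi> (f j)) \<longlonglongrightarrow> \<Phi> h"
    if "\<forall>K. compact K \<longrightarrow> K \<subseteq> \<Omega> \<longrightarrow> uniform_limit K f h sequentially" for f h
    unfolding tendsto_fun_iff \<Phi>_def
  proof
    fix n
    have "compact {q n}" "{q n} \<subseteq> \<Omega>" using q by auto
    with that have "uniform_limit {q n} f h sequentially" by blast
    then show "(\<lambda>j. f j (q n)) \<longlonglongrightarrow> h (q n)" by (rule tendsto_uniform_limitI) simp
  qed
  \<comment> \<open>The map \<open>h\<close> is a limit of members of \<open>F\<close>: a
    subsequence of curves whose samples approach \<open>\<Phi> h\<close> converges in the class, and
    its limit has the same samples. The assumption \<open>lim\<close> then places its values in
    \<open>M\<close>.\<close>
  have in_M: "h \<in> Hol X \<Omega> M" if h: "h \<in> ?G" and cl: "\<Phi> h \<in> closure (\<Phi> ` F)" for h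
  proof -
    obtain b where b: "\<And>k. b k \<in> \<Phi> ` F" "b \<longlonglongrightarrow> \<Phi> h"
      using cl unfolding closure_sequential by blast
    then have "\<forall>k. \<exists>g\<in>F. b k = \<Phi> g" by blast
    then obtain g where g: "\<And>k. g k \<in> F" "\<And>k. b k = \<Phi> (g k)" by metis
    have gG: "g k \<in> ?G" for k using g(1) FG by blast
    obtain r g' where r: "strict_mono r" "g' \<in> ?G"
      and ul: "\<forall>K. compact K \<longrightarrow> K \<subseteq> \<Omega> \<longrightarrow> uniform_limit K (g \<circ> r) g' sequentially"
      and cc: "curves_converge \<Omega> (g \<circ> r) g'"
      using sub[of g, OF _ gG] by blast
    have "(\<lambda>j. \<Phi> ((g \<circ> r) j)) \<longlonglongrightarrow> \<Phi> g'" by (rule \<Phi>_lim[OF ul])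
    moreover have "(\<lambda>j. \<Phi> ((g \<circ> r) j)) \<longlonglongrightarrow> \<Phi> h"
      using LIMSEQ_subseq_LIMSEQ[OF b(2) r(1)] by (simp add: o_def g(2))
    ultimately have "\<Phi> g' = \<Phi> h" by (rule LIMSEQ_unique)
    then have "g' = h" using inj[OF r(2) h] by blast
    moreover have "\<forall>z\<in>\<Omega>. g' z \<in> M"
      by (rule lim[OF _ ul cc]) (use g in simp)
    ultimately show ?thesis using h by (auto simp: bounded_curves_def Hol_def)
  qed
  \<comment> \<open>The closure of \<open>F\<close> as seen through the samples. It is closed under
    the limits of \<open>sub\<close>, and \<open>in_M\<close> keeps it among maps into
    \<open>M\<close>.\<close>
  define C where "C = {f \<in> ?G. \<Phi> f \<in> closure (\<Phi> ` F)}"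
  have CG: "f \<in> ?G" if "f \<in> C" for f using that by (simp add: C_def)
  have CH: "C \<subseteq> Hol X \<Omega> M" using in_M by (auto simp: C_def)
  have FC: "F \<subseteq> C" using FG closure_subset[of "\<Phi> ` F"] by (auto simp: C_def)
  have injC: "inj_on \<Phi> C" using inj CG by (auto intro: inj_onI)
  have subC: "\<exists>r h. strict_mono r \<and> h \<in> C \<and>
      (\<forall>K. compact K \<longrightarrow> K \<subseteq> \<Omega> \<longrightarrow> uniform_limit K (f \<circ> r) h sequentially) \<and>
      (\<lambda>j. \<Phi> ((f \<circ> r) j)) \<longlonglongrightarrow> \<Phi> h" if f: "\<And>j. f j \<in> C" for f :: "nat \<Rightarrow> complex \<Rightarrow> 'x"
  proof -
    have fG: "f j \<in> ?G" for j by (rule CG[OF f])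
    obtain r h where r: "strict_mono r" "h \<in> ?G"
      and ul: "\<forall>K. compact K \<longrightarrow> K \<subseteq> \<Omega> \<longrightarrow> uniform_limit K (f \<circ> r) h sequentially"
      using sub[of f, OF _ fG] by blast
    have lim\<Phi>: "(\<lambda>j. \<Phi> ((f \<circ> r) j)) \<longlonglongrightarrow> \<Phi> h" by (rule \<Phi>_lim[OF ul])
    have "\<Phi> h \<in> closure (\<Phi> ` F)"
      by (rule closed_sequentially[OF closed_closure _ lim\<Phi>]) (use f in \<open>auto simp: C_def\<close>)
    then show ?thesis using r ul lim\<Phi> by (auto simp: C_def)
  qed
  have "compact (\<Phi> ` C)"
    unfolding compact_eq_seq_compact_metric seq_compact_def
  proof (intro allI impI)
    fix a :: "nat \<Rightarrow> nat \<Rightarrow> 'x" assume "\<forall>n. a n \<in> \<Phi> ` C"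
    then have "\<forall>n. \<exists>f\<in>C. a n = \<Phi> f" by blast
    then obtain f where f: "\<And>n. f n \<in> C" "\<And>n. a n = \<Phi> (f n)" by metis
    obtain r h where r: "strict_mono r" "h \<in> C" and "(\<lambda>j. \<Phi> ((f \<circ> r) j)) \<longlonglongrightarrow> \<Phi> h"
      using subC[of f, OF f(1)] by blast
    moreover have "a \<circ> r = (\<lambda>j. \<Phi> ((f \<circ> r) j))" by (simp add: fun_eq_iff f(2))
    ultimately have "(a \<circ> r) \<longlonglongrightarrow> \<Phi> h" by (simp only:)
    then show "\<exists>l\<in>\<Phi> ` C. \<exists>r. strict_mono r \<and> (a \<circ> r) \<longlonglongrightarrow> l"
      using r by blast
  qed
  then have cpt\<Phi>: "compactin (top_of_set (\<Phi> ` C)) (\<Phi> ` C)"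
    by (simp add: compactin_subtopology)
  let ?T = "compact_open_topology X \<Omega> M"
  define \<Psi> where "\<Psi> = inv_into C \<Phi>"
  have \<Psi>: "\<Psi> (\<Phi> f) = f" if "f \<in> C" for f
    using that injC by (simp add: \<Psi>_def)
  have cont: "continuous_map (top_of_set (\<Phi> ` C)) ?T \<Psi>"
    unfolding compact_open_topology_def
  proof (rule continuous_on_generated_topo)
    have "\<Psi> ` \<Phi> ` C \<subseteq> Hol X \<Omega> M" using \<Psi> CH by auto
    then show "\<Psi> ` topspace (top_of_set (\<Phi> ` C)) \<subseteq>
        \<Union> {{f \<in> Hol X \<Omega> M. f ` K \<subseteq> U} |K U. compact K \<and> K \<subseteq> \<Omega> \<and> openin (top_of_set M) U}"
      using topspace_compact_open[of X \<Omega> M]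
      unfolding compact_open_topology_def topology_generated_by_topspace by simp
  next
    fix W assume "W \<in> {{f \<in> Hol X \<Omega> M. f ` K \<subseteq> U} |K U. compact K \<and> K \<subseteq> \<Omega> \<and> openin (top_of_set M) U}"
    then obtain K U where K: "compact K" "K \<subseteq> \<Omega>" and U: "openin (top_of_set M) U"
      and W: "W = {f \<in> Hol X \<Omega> M. f ` K \<subseteq> U}" by blast
    obtain V where V: "open V" "U = M \<inter> V" using U by (auto simp: openin_open)
    \<comment> \<open>Otherwise there are maps in \<open>C\<close> outside \<open>W\<close> whose
      samples tend to \<open>x\<close>. By \<open>subC\<close> a subsequence converges uniformly on
      \<open>K\<close>, its limit has samples \<open>x\<close> and so lies in \<open>W\<close>, and
      closeness on \<open>K\<close> brings late terms into \<open>W\<close> too.\<close>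
    have "\<exists>e>0. \<forall>x'\<in>\<Phi> ` C. dist x' x < e \<longrightarrow> \<Psi> x' \<in> W" if x: "x \<in> \<Phi> ` C" "\<Psi> x \<in> W" for x
    proof (rule ccontr)
      assume "\<not> ?thesis"
      then have "\<exists>f\<in>C. dist (\<Phi> f) x < e \<and> f \<notin> W" if "e > 0" for e
        using that \<Psi> by (metis imageE)
      then have "\<forall>k. \<exists>f\<in>C. dist (\<Phi> f) x < inverse (real (Suc k)) \<and> f \<notin> W" by simp
      then obtain f where f: "\<And>k. f k \<in> C" "\<And>k. dist (\<Phi> (f k)) x < inverse (real (Suc k))"
        "\<And>k. f k \<notin> W" by metis
      obtain r h where r: "strict_mono r" "h \<in> C" 
        and ul: "\<forall>K. compact K \<longrightarrow> K \<subseteq> \<Omega> \<longrightarrow> uniform_limit K (f \<circ> r) h sequentially"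
        and lim\<Phi>: "(\<lambda>j. \<Phi> ((f \<circ> r) j)) \<longlonglongrightarrow> \<Phi> h"
        using subC[of f, OF f(1)] by blast
      have "(\<lambda>k. \<Phi> (f k)) \<longlonglongrightarrow> x"
      proof (rule metric_tendsto_imp_tendsto[OF LIMSEQ_inverse_real_of_nat always_eventually], rule allI)
        show "dist (\<Phi> (f k)) x \<le> dist (inverse (real (Suc k))) 0" for k
          using f(2)[of k] by (simp add: dist_real_def del: of_nat_Suc)
      qed
      then have "((\<lambda>k. \<Phi> (f k)) \<circ> r) \<longlonglongrightarrow> x"
        using r(1) by (rule LIMSEQ_subseq_LIMSEQ)
      then have "(\<lambda>j. \<Phi> ((f \<circ> r) j)) \<longlonglongrightarrow> x" by (simp add: o_def)
      then have "x = \<Phi> h" using lim\<Phi> by (rule LIMSEQ_unique)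
      then have hW: "h \<in> W" using x(2) \<Psi>[OF r(2)] by simp
      have "continuous_on K h"
        using r(2) CH K unfolding Hol_def holo_curve_on_def by (auto intro: continuous_on_subset)
      then have "compact (h ` K)" using K(1) by (rule compact_continuous_image)
      moreover have "closed (- V)" using V(1) by (simp add: closed_Compl)
      moreover have "- V \<inter> h ` K = {}" using hW V by (auto simp: W)
      ultimately obtain d where d: "d > 0" "\<forall>x\<in>- V. \<forall>y\<in>h ` K. d \<le> dist x y"
        using compact_separated[of "- V" "h ` K"] by blast
      have "uniform_limit K (f \<circ> r) h sequentially" using ul K by blast
      then have "\<forall>\<^sub>F j in sequentially. \<forall>z\<in>K. dist ((f \<circ> r) j z) (h z) < d"
        using d(1) by (rule uniform_limitD)
      then obtain j where j: "\<forall>z\<in>K. dist (f (r j) z) (h z) < d"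
        unfolding eventually_sequentially by auto
      have "f (r j) z \<in> V" if z: "z \<in> K" for z
      proof (rule ccontr)
        assume "f (r j) z \<notin> V"
        then have "d \<le> dist (f (r j) z) (h z)" using d(2) z by blast
        then show False using j z by force
      qed
      moreover have "f (r j) \<in> Hol X \<Omega> M" using f(1) CH by blast
      moreover from this have "f (r j) z \<in> M" if "z \<in> K" for z
        using that K by (auto simp: Hol_def)
      ultimately have "f (r j) \<in> W" unfolding W V(2) by blast
      then show False using f(3) by blast
    qed
    then show "openin (top_of_set (\<Phi> ` C)) (\<Psi> -` W \<inter> topspace (top_of_set (\<Phi> ` C)))"
      unfolding openin_euclidean_subtopology_iff by auto
  qed
  have "compactin ?T (\<Psi> ` \<Phi> ` C)" by (rule image_compactin[OF cpt\<Phi> cont])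
  moreover have "\<Psi> ` \<Phi> ` C = C" using \<Psi> by force
  ultimately have C: "compactin ?T C" by simp
  \<comment> \<open>Compact sets are closed in this Hausdorff topology, so \<open>C\<close> contains
    the closure of \<open>F\<close>, which is then a closed subset of a compact set.\<close>
  have "closedin ?T C" by (rule compactin_imp_closedin[OF Hausdorff_compact_open C])
  then have "?T closure_of F \<subseteq> C" using FC by (intro closure_of_minimal)
  then show ?thesis
    unfolding normal_family_def by (rule closed_compactin[OF C _ closedin_closure_of])
qed

end

section \<open>Rescaling and normality\<close>

context compact_hermitian_space
begin

text \<open>For each fixed \<open>\<xi>\<close> the points \<open>p j + \<rho> j * \<xi>\<close>
  tend to \<open>p0\<close>, so they end up in a disc where \<open>h\<close> is near
  \<open>y = h p0\<close>, and infinitely many \<open>f j\<close> map this disc near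
  \<open>y\<close>. Two parameters are treated with a common index, since separate statements about
  infinitely many indices could not be combined.\<close>

lemma normal_family_rescaling_cluster:
  assumes \<Omega>: "open \<Omega>" "p0 \<in> \<Omega>" and norm: "normal_family X \<Omega> M F" and FH: "F \<subseteq> Hol X \<Omega> M"
    and f: "\<And>j. f j \<in> F" and p: "p \<longlonglongrightarrow> p0" and \<rho>: "\<rho> \<longlonglongrightarrow> (0::real)"
  obtains y where "y \<in> M"
    "\<forall>e>0. \<forall>\<xi> \<xi>' N. \<exists>j\<ge>N. dist (f j (p j + of_real (\<rho> j) * \<xi>)) y < e \<and>
      dist (f j (p j + of_real (\<rho> j) * \<xi>')) y < e"
proof -
  obtain h where h: "h \<in> Hol X \<Omega> M"
    and cluster: "\<forall>K U. compact K \<longrightarrow> K \<subseteq> \<Omega> \<longrightarrow> openin (top_of_set M) U \<longrightarrow> h ` K \<subseteq> U \<longrightarrow>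
      (\<forall>N. \<exists>j\<ge>N. f j ` K \<subseteq> U)"
    by (rule bexE[OF normal_family_cluster[OF norm FH f]])
  have hM: "h z \<in> M" if "z \<in> \<Omega>" for z using h that by (auto simp: Hol_def)
  have hcurve: "holo_curve_on X \<Omega> h" using h by (simp add: Hol_def)
  have near: "\<exists>j\<ge>N. dist (f j (p j + of_real (\<rho> j) * \<xi>)) (h p0) < e \<and>
      dist (f j (p j + of_real (\<rho> j) * \<xi>')) (h p0) < e" if e: "0 < e" for e \<xi> \<xi>' and N :: nat
  proof -
    have "open {z\<in>\<Omega>. h z \<in> ball (h p0) e}" by (rule curve_preimage_open[OF hcurve open_ball])
    moreover have "p0 \<in> {z\<in>\<Omega>. h z \<in> ball (h p0) e}" using \<Omega> e by simp
    ultimately obtain r where r: "r > 0" "cball p0 r \<subseteq> {z\<in>\<Omega>. h z \<in> ball (h p0) e}"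
      using open_contains_cball by blast
    have ev: "\<forall>\<^sub>F j in sequentially. p j + of_real (\<rho> j) * \<xi> \<in> ball p0 r" for \<xi> :: complex
    proof (rule topological_tendstoD)
      have "(\<lambda>j. p j + of_real (\<rho> j) * \<xi>) \<longlonglongrightarrow> p0 + of_real 0 * \<xi>"
        by (intro tendsto_intros p \<rho>)
      then show "(\<lambda>j. p j + of_real (\<rho> j) * \<xi>) \<longlonglongrightarrow> p0" by simp
    qed (use r in auto)
    obtain N' where N': "\<And>j. j \<ge> N' \<Longrightarrow> p j + of_real (\<rho> j) * \<xi> \<in> ball p0 r"
      "\<And>j. j \<ge> N' \<Longrightarrow> p j + of_real (\<rho> j) * \<xi>' \<in> ball p0 r"
      using eventually_conj[OF ev[of \<xi>] ev[of \<xi>']] unfolding eventually_sequentially by blast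
    let ?U = "M \<inter> ball (h p0) e"
    have "openin (top_of_set M) ?U" by (intro openin_open_Int) simp
    moreover have "cball p0 r \<subseteq> \<Omega>" "h ` cball p0 r \<subseteq> ?U" using r(2) hM by auto
    moreover have "compact (cball p0 r)" by simp
    ultimately obtain j where j: "j \<ge> max N N'" "f j ` cball p0 r \<subseteq> ?U"
      using cluster by blast
    have "f j z \<in> ball (h p0) e" if "z \<in> ball p0 r" for z
      using j(2) that ball_subset_cball by blast
    then have "f j (p j + of_real (\<rho> j) * \<xi>) \<in> ball (h p0) e"
      "f j (p j + of_real (\<rho> j) * \<xi>') \<in> ball (h p0) e"
      using N' j(1) by simp_all
    then show ?thesis using j(1) by (intro exI[of _ j]) (simp add: dist_commute)
  qed
  show thesis
    by (rule that[OF hM[OF \<Omega>(2)]]) (intro allI impI near)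
qed

text \<open>A closed ball about the cluster value \<open>y\<close> inside the open set
  \<open>M\<close> is compact, and the values at the origin return to it infinitely often.\<close>

lemma not_normal_if_compactly_divergent:
  assumes \<Omega>: "open \<Omega>" "p0 \<in> \<Omega>" and M: "open M" and FH: "F \<subseteq> Hol X \<Omega> M"
    and f: "\<And>j. f j \<in> F" and p: "p \<longlonglongrightarrow> p0" and \<rho>: "\<rho> \<longlonglongrightarrow> (0::real)"
    and div: "compactly_divergent M Dm (\<lambda>j \<xi>. f j (p j + of_real (\<rho> j) * \<xi>))"
  shows "\<not> normal_family X \<Omega> M F"
proof
  assume norm: "normal_family X \<Omega> M F"
  obtain y where y: "y \<in> M" and near: "\<forall>e>0. \<forall>\<xi> \<xi>' N. \<exists>j\<ge>N.
      dist (f j (p j + of_real (\<rho> j) * \<xi>)) y < e \<and> dist (f j (p j + of_real (\<rho> j) * \<xi>')) y < e"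
    by (rule normal_family_rescaling_cluster[OF \<Omega> norm FH f p \<rho>])
  obtain e where e: "e > 0" "cball y e \<subseteq> M" using M y open_contains_cball by blast
  have "compact (cball y e)" by (rule closed_compact) simp
  then have "\<exists>j0. \<forall>j\<ge>j0. {0} \<subseteq> Dm j \<and> (\<lambda>\<xi>. f j (p j + of_real (\<rho> j) * \<xi>)) ` {0} \<inter> cball y e = {}"
    using e(2) by (intro div[unfolded compactly_divergent_def, rule_format]) auto
  then obtain j0 where
    j0: "\<forall>j\<ge>j0. {0} \<subseteq> Dm j \<and> (\<lambda>\<xi>. f j (p j + of_real (\<rho> j) * \<xi>)) ` {0} \<inter> cball y e = {}" ..
  from near[rule_format, OF e(1), of j0 0 0] obtain j
    where j: "j \<ge> j0" "dist (f j (p j + of_real (\<rho> j) * 0)) y < e" by blast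
  from j0 j(1) have "f j (p j + of_real (\<rho> j) * 0) \<notin> cball y e" by blast
  then show False using j(2) by (simp add: dist_commute)
qed

text \<open>Infinitely often the rescaled maps are close to the same value \<open>y\<close> at two
  points where \<open>h\<close> takes different values.\<close>

lemma not_normal_if_nonconstant_limit:
  assumes \<Omega>: "open \<Omega>" "p0 \<in> \<Omega>" and FH: "F \<subseteq> Hol X \<Omega> M"
    and f: "\<And>j. f j \<in> F" and p: "p \<longlonglongrightarrow> p0" and \<rho>: "\<rho> \<longlonglongrightarrow> (0::real)"
    and h: "\<not> h constant_on UNIV"
    and lim: "locally_uniformly_convergent Dm (\<lambda>j \<xi>. f j (p j + of_real (\<rho> j) * \<xi>)) h"
  shows "\<not> normal_family X \<Omega> M F"
proof
  assume norm: "normal_family X \<Omega> M F"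
  obtain y where y: "y \<in> M" and near: "\<forall>e>0. \<forall>\<xi> \<xi>' N. \<exists>j\<ge>N.
      dist (f j (p j + of_real (\<rho> j) * \<xi>)) y < e \<and> dist (f j (p j + of_real (\<rho> j) * \<xi>')) y < e"
    by (rule normal_family_rescaling_cluster[OF \<Omega> norm FH f p \<rho>])
  obtain \<xi> \<xi>' where ne: "h \<xi> \<noteq> h \<xi>'" using h unfolding constant_on_def by blast
  \<comment> \<open>The path from \<open>h \<xi>\<close> to its approximation, to \<open>y\<close>,
    to the other approximation and on to \<open>h \<xi>'\<close> has four steps, each shorter than
    \<open>e\<close>.\<close>
  define e where "e = dist (h \<xi>) (h \<xi>') / 4"
  have e: "e > 0" using ne by (simp add: e_def)
  have "uniform_limit {\<xi>, \<xi>'} (\<lambda>j \<xi>. f j (p j + of_real (\<rho> j) * \<xi>)) h sequentially"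
    by (rule lim[unfolded locally_uniformly_convergent_def, rule_format, THEN conjunct2]) simp
  from uniform_limitD[OF this e] obtain N where
    N: "\<And>j. j \<ge> N \<Longrightarrow> dist (f j (p j + of_real (\<rho> j) * \<xi>)) (h \<xi>) < e"
      "\<And>j. j \<ge> N \<Longrightarrow> dist (f j (p j + of_real (\<rho> j) * \<xi>')) (h \<xi>') < e"
    unfolding eventually_sequentially by blast
  from near[rule_format, OF e, of N \<xi> \<xi>'] obtain j
    where j: "j \<ge> N" "dist (f j (p j + of_real (\<rho> j) * \<xi>)) y < e"
      "dist (f j (p j + of_real (\<rho> j) * \<xi>')) y < e"
    by blast
  have "dist (h \<xi>) y < 2 * e" "dist (h \<xi>') y < 2 * e"
    using N[OF j(1)] j(2,3) dist_triangle3[of "h \<xi>" y "f j (p j + of_real (\<rho> j) * \<xi>)"]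
      dist_triangle3[of "h \<xi>'" y "f j (p j + of_real (\<rho> j) * \<xi>')"] by linarith+
  then have "dist (h \<xi>) (h \<xi>') < 4 * e"
    using dist_triangle2[of "h \<xi>" "h \<xi>'" y] by linarith
  then show False by (simp add: e_def)
qed

text \<open>The case distinction is not the one between (i) and (ii): locally bounded length always
  leads to (i), while unbounded length leads to (i) or (ii) according to whether the Zalcman limit
  lies in \<open>S\<close> or avoids it.\<close>

lemma rescaling_if_not_normal:
  assumes \<Omega>: "open \<Omega>" "connected \<Omega>" "\<Omega> \<noteq> {}" and S: "complex_hypersurface X S"
    and FH: "F \<subseteq> Hol X \<Omega> (UNIV - S)" and nn: "\<not> normal_family X \<Omega> (UNIV - S) F"
  shows "\<exists>p p0 f \<rho>. (\<forall>j::nat. p j \<in> \<Omega>) \<and> p0 \<in> \<Omega> \<and> p \<longlonglongrightarrow> p0 \<and> (\<forall>j. f j \<in> F) \<and>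
    (\<forall>j. (\<rho> j :: real) > 0) \<and> \<rho> \<longlonglongrightarrow> 0 \<and>
    (let g = (\<lambda>j \<xi>. f j (p j + of_real (\<rho> j) * \<xi>));
         Dm = (\<lambda>j. {\<xi>. p j + of_real (\<rho> j) * \<xi> \<in> \<Omega>})
     in compactly_divergent (UNIV - S) Dm g \<or>
        (\<exists>h. E_Brody_curve X E (UNIV - S) h \<and> \<not> h constant_on UNIV \<and>
             locally_uniformly_convergent Dm g h))"
proof (cases "\<forall>p\<in>\<Omega>. \<exists>r C. 0 < r \<and> cball p r \<subseteq> \<Omega> \<and> (\<forall>f\<in>F. \<forall>z\<in>cball p r. E_length X E f z \<le> C)")
  case True
  have closedS: "closed S" using S unfolding complex_hypersurface_def closed_analytic_subset_def by blast
  \<comment> \<open>With the length bounds at hand, the failure of \<open>normal_familyI\<close> can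
    only be due to a limit that leaves \<open>M\<close>.\<close>
  have "\<exists>f h. (\<forall>j::nat. f j \<in> F) \<and> (\<forall>K. compact K \<longrightarrow> K \<subseteq> \<Omega> \<longrightarrow> uniform_limit K f h sequentially) \<and>
      curves_converge \<Omega> f h \<and> \<not> (\<forall>z\<in>\<Omega>. h z \<in> UNIV - S)"
  proof (rule ccontr)
    assume no: "\<not> ?thesis"
    have "normal_family X \<Omega> (UNIV - S) F"
    proof (rule normal_familyI[OF \<Omega>(1,3) FH])
      show "\<exists>r C. 0 < r \<and> cball p r \<subseteq> \<Omega> \<and> (\<forall>f\<in>F. \<forall>z\<in>cball p r. E_length X E f z \<le> C)"
        if "p \<in> \<Omega>" for p
        using True that by (rule bspec)
      fix f :: "nat \<Rightarrow> complex \<Rightarrow> 'x" and h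
      assume f: "\<And>j. f j \<in> F" and lim: "\<forall>K. compact K \<longrightarrow> K \<subseteq> \<Omega> \<longrightarrow> uniform_limit K f h sequentially"
        and conv: "curves_converge \<Omega> f h"
      show "\<forall>z\<in>\<Omega>. h z \<in> UNIV - S"
      proof (rule ccontr)
        assume "\<not> (\<forall>z\<in>\<Omega>. h z \<in> UNIV - S)"
        with allI[of "\<lambda>j. f j \<in> F", OF f] lim conv have "\<exists>f h. (\<forall>j::nat. f j \<in> F) \<and> (\<forall>K. compact K \<longrightarrow> K \<subseteq> \<Omega> \<longrightarrow>
            uniform_limit K f h sequentially) \<and> curves_converge \<Omega> f h \<and> \<not> (\<forall>z\<in>\<Omega>. h z \<in> UNIV - S)"
          by (intro exI[of _ f] exI[of _ h] conjI)
        with no show False ..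
      qed
    qed
    with nn show False ..
  qed
  then obtain f h where f: "\<And>j::nat. f j \<in> F"
    and lim: "\<forall>K. compact K \<longrightarrow> K \<subseteq> \<Omega> \<longrightarrow> uniform_limit K f h sequentially"
    and conv: "curves_converge \<Omega> f h" and notM: "\<not> (\<forall>z\<in>\<Omega>. h z \<in> UNIV - S)"
    by blast
  have "\<exists>r>0. \<forall>\<^sub>F j in sequentially. \<forall>w\<in>ball z r. f j w \<notin> S" if z: "z \<in> \<Omega>" for z
  proof -
    obtain r where r: "r > 0" "ball z r \<subseteq> \<Omega>" using \<Omega>(1) z open_contains_ball by blast
    have "f j w \<notin> S" if "w \<in> \<Omega>" for j w
      using subsetD[OF FH f[of j]] that by (auto simp: Hol_def)
    then have "\<forall>w\<in>ball z r. f j w \<notin> S" for j using r(2) by blast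
    then show ?thesis using r(1) by (intro exI[of _ r]) simp
  qed
  then have "(\<forall>z\<in>\<Omega>. h z \<notin> S) \<or> (\<forall>z\<in>\<Omega>. h z \<in> S)"
    by (rule hurwitz_dichotomy[OF \<Omega>(1,2) S conv])
  with notM have hS: "\<And>z. z \<in> \<Omega> \<Longrightarrow> h z \<in> S" by blast
  obtain p0 where p0: "p0 \<in> \<Omega>" using \<Omega>(3) by blast
  obtain r where r: "r > 0" "cball p0 r \<subseteq> \<Omega>" using \<Omega>(1) p0 open_contains_cball by blast
  \<comment> \<open>The maps \<open>f j\<close> themselves already approach \<open>S\<close>
    uniformly on a disc about \<open>p0\<close>, so every null sequence of positive scales will
    do.\<close>
  define \<rho> where "\<rho> = (\<lambda>j. inverse (real (Suc j)))"
  have \<rho>: "\<rho> \<longlonglongrightarrow> 0" unfolding \<rho>_def by (rule LIMSEQ_inverse_real_of_nat)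
  have \<rho>_pos: "\<rho> j > 0" for j by (simp add: \<rho>_def)
  have "compactly_divergent (UNIV - S) (\<lambda>j. {\<xi>. p0 + of_real (\<rho> j) * \<xi> \<in> \<Omega>})
      (\<lambda>j \<xi>. f j (p0 + of_real (\<rho> j) * \<xi>))"
  proof (rule compactly_divergentI[OF closedS])
    fix K :: "complex set" and d :: real assume K: "compact K" and d: "0 < d"
    obtain B where B: "B > 0" "\<And>\<xi>. \<xi> \<in> K \<Longrightarrow> norm \<xi> \<le> B"
      using compact_imp_bounded[OF K] bounded_pos by metis
    \<comment> \<open>As \<open>K\<close> lies in the disc of radius \<open>B\<close>, such scales
      map it into \<open>cball p0 r\<close>, where the convergence to \<open>h\<close> is
      uniform.\<close>
    have "\<forall>\<^sub>F j in sequentially. \<rho> j < r / B"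
      using \<rho> r(1) B(1) by (intro order_tendstoD(2)) auto
    moreover have "\<forall>\<^sub>F j in sequentially. \<forall>z\<in>cball p0 r. dist (f j z) (h z) < d"
      using lim r(2) compact_cball[of p0 r] d by (blast intro: uniform_limitD)
    ultimately show "\<forall>\<^sub>F j in sequentially. K \<subseteq> {\<xi>. p0 + of_real (\<rho> j) * \<xi> \<in> \<Omega>} \<and>
        (\<forall>\<xi>\<in>K. \<exists>x\<in>S. dist (f j (p0 + of_real (\<rho> j) * \<xi>)) x < d)"
    proof eventually_elim
      case (elim j)
      have "p0 + of_real (\<rho> j) * \<xi> \<in> cball p0 r" if \<xi>: "\<xi> \<in> K" for \<xi>
      proof -
        have "\<rho> j * norm \<xi> \<le> (r / B) * B"
          using elim(1) B(2)[OF \<xi>] B(1) r(1) by (intro mult_mono) auto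
        then show ?thesis using B(1) \<rho>_pos[of j] by (simp add: dist_norm norm_mult)
      qed
      then show ?case using elim(2) hS r(2) by blast
    qed
  qed
  then show ?thesis
    unfolding Let_def
    by (intro exI[of _ "\<lambda>_. p0"] exI[of _ p0] exI[of _ f] exI[of _ \<rho>] conjI disjI1 allI f p0 \<rho> \<rho>_pos tendsto_const)
next
  case False
  have closedS: "closed S" using S unfolding complex_hypersurface_def closed_analytic_subset_def by blast
  obtain p where p: "p \<in> \<Omega>"
    and bad: "\<not> (\<exists>r C. 0 < r \<and> cball p r \<subseteq> \<Omega> \<and> (\<forall>f\<in>F. \<forall>z\<in>cball p r. E_length X E f z \<le> C))"
    using False by blast
  have unbdd: "\<exists>f\<in>F. \<exists>z\<in>cball p r. C < E_length X E f z" if "0 < r" "cball p r \<subseteq> \<Omega>" for r C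
    using bad that by (meson not_le)
  have hol: "holo_curve_on X \<Omega> f" if "f \<in> F" for f using FH that by (auto simp: Hol_def)
  obtain q q0 f \<rho> h where q: "\<And>j::nat. q j \<in> \<Omega>" "q0 \<in> \<Omega>" "q \<longlonglongrightarrow> q0"
    and f: "\<And>j. f j \<in> F" and \<rho>: "\<And>j. 0 < \<rho> j" "\<rho> \<longlonglongrightarrow> 0"
    and dom: "\<And>K. compact K \<Longrightarrow> \<forall>\<^sub>F j in sequentially. K \<subseteq> {\<xi>. q j + of_real (\<rho> j) * \<xi> \<in> \<Omega>}"
    and lim: "\<And>K. compact K \<Longrightarrow> uniform_limit K (\<lambda>j \<xi>. f j (q j + of_real (\<rho> j) * \<xi>)) h sequentially"
    and conv: "curves_converge UNIV (\<lambda>j \<xi>. f j (q j + of_real (\<rho> j) * \<xi>)) h"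
    and h2: "\<And>z. E_length X E h z \<le> 2" and h1: "E_length X E h 0 = 1"
    by (rule zalcman_rescaling[OF \<Omega>(1) hol p unbdd]) (assumption | rule that)+
  let ?Dm = "\<lambda>j. {\<xi>. q j + of_real (\<rho> j) * \<xi> \<in> \<Omega>}" and ?g = "\<lambda>j \<xi>. f j (q j + of_real (\<rho> j) * \<xi>)"
  have holoh: "holo_curve_on X UNIV h" by (rule curves_converge_holo[OF open_UNIV conv])
  have "\<exists>r>0. \<forall>\<^sub>F j in sequentially. \<forall>w\<in>ball z r. ?g j w \<notin> S" for z
  proof -
    have fS: "f j w \<notin> S" if "w \<in> \<Omega>" for j w
      using subsetD[OF FH f[of j]] that by (auto simp: Hol_def)
    \<comment> \<open>Only parameters that land in \<open>\<Omega>\<close> are known to give values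
      off \<open>S\<close>, so the disc must first enter the domain of the rescaled map.\<close>
    have "\<forall>\<^sub>F j in sequentially. cball z 1 \<subseteq> ?Dm j" by (rule dom) simp
    then have "\<forall>\<^sub>F j in sequentially. \<forall>w\<in>ball z 1. ?g j w \<notin> S"
      by eventually_elim (use fS ball_subset_cball[of z 1] in blast)
    then show ?thesis by (intro exI[of _ 1]) simp
  qed
  then have "(\<forall>z\<in>UNIV. h z \<notin> S) \<or> (\<forall>z\<in>UNIV. h z \<in> S)"
    by (rule hurwitz_dichotomy[OF open_UNIV connected_UNIV S conv])
  then have "compactly_divergent (UNIV - S) ?Dm ?g \<or>
      (\<exists>h. E_Brody_curve X E (UNIV - S) h \<and> \<not> h constant_on UNIV \<and>
           locally_uniformly_convergent ?Dm ?g h)"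
  proof
    assume hM: "\<forall>z\<in>UNIV. h z \<notin> S"
    have "E_length X E h z \<in> {0..2}" for z
      using E_length_nonneg[OF holoh] h2 by simp
    then have "bounded (range (E_length X E h))"
      by (intro bounded_subset[OF bounded_closed_interval[of 0 2]]) blast
    then have "E_Brody_curve X E (UNIV - S) h"
      using holoh hM by (auto simp: E_Brody_curve_def Hol_def PiE_def)
    \<comment> \<open>A constant curve has length zero, against the length one of \<open>h\<close>
      at the origin.\<close>
    moreover have "\<not> h constant_on UNIV"
    proof
      assume "h constant_on UNIV"
      then obtain x where "h = (\<lambda>_. x)" unfolding constant_on_def by blast
      then show False using h1 E_length_const[of x 0] by simp
    qed
    moreover have "locally_uniformly_convergent ?Dm ?g h"
      unfolding locally_uniformly_convergent_def
      using dom lim by (simp add: eventually_sequentially)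
    ultimately show ?thesis by blast
  next
    assume hS: "\<forall>z\<in>UNIV. h z \<in> S"
    have "compactly_divergent (UNIV - S) ?Dm ?g"
    proof (rule compactly_divergentI[OF closedS])
      fix K :: "complex set" and d :: real assume K: "compact K" and d: "0 < d"
      show "\<forall>\<^sub>F j in sequentially. K \<subseteq> ?Dm j \<and> (\<forall>\<xi>\<in>K. \<exists>x\<in>S. dist (?g j \<xi>) x < d)"
        using dom[OF K] uniform_limitD[OF lim[OF K] d]
        by eventually_elim (use hS in blast)
    qed
    then show ?thesis ..
  qed
  then show ?thesis
    unfolding Let_def using q f \<rho> by blast
qed

end

theorem theorem1p9:
  fixes X :: "('x::metric_space, 'n::finite) chart set"
    and E :: "('x, 'n) chart \<Rightarrow> complex^'n \<Rightarrow> complex^'n^'n"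
    and S M :: "'x set" and \<Omega> :: "complex set" and F :: "(complex \<Rightarrow> 'x) set"
  assumes "open \<Omega>" and "connected \<Omega>" and "\<Omega> \<noteq> {}"
    and "complex_space X" and "compact (UNIV :: 'x set)"
    and "hermitian_metric X E"
    and "complex_hypersurface X S" and "M = UNIV - S"
    and "F \<subseteq> Hol X \<Omega> M"
  shows "\<not> normal_family X \<Omega> M F \<longleftrightarrow>
    (\<exists>p p0 f \<rho>. (\<forall>j::nat. p j \<in> \<Omega>) \<and> p0 \<in> \<Omega> \<and> p \<longlonglongrightarrow> p0 \<and> (\<forall>j. f j \<in> F) \<and>
       (\<forall>j. (\<rho> j :: real) > 0) \<and> \<rho> \<longlonglongrightarrow> 0 \<and>
       (let g = (\<lambda>j \<xi>. f j (p j + of_real (\<rho> j) * \<xi>));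
            Dm = (\<lambda>j. {\<xi>. p j + of_real (\<rho> j) * \<xi> \<in> \<Omega>})
        in compactly_divergent M Dm g \<or>
           (\<exists>h. E_Brody_curve X E M h \<and> \<not> h constant_on UNIV \<and>
                locally_uniformly_convergent Dm g h)))"
    (is "?L \<longleftrightarrow> ?R")
proof -
  interpret compact_hermitian_space X E
    by unfold_locales (fact assms)+
  have M: "open M"
    using assms(7,8) unfolding complex_hypersurface_def closed_analytic_subset_def by auto
  show ?thesis
  proof
    assume ?L
    then show ?R
      using rescaling_if_not_normal[OF assms(1-3,7), of F] assms(8,9) by simp
  next
    assume ?R
    then obtain p p0 f and \<rho> :: "nat \<Rightarrow> real" where p: "p0 \<in> \<Omega>" "p \<longlonglongrightarrow> p0"
      and f: "\<forall>j. f j \<in> F" and \<rho>: "\<rho> \<longlonglongrightarrow> 0"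
      and alt: "let g = (\<lambda>j \<xi>. f j (p j + of_real (\<rho> j) * \<xi>));
            Dm = (\<lambda>j. {\<xi>. p j + of_real (\<rho> j) * \<xi> \<in> \<Omega>})
        in compactly_divergent M Dm g \<or>
           (\<exists>h. E_Brody_curve X E M h \<and> \<not> h constant_on UNIV \<and>
                locally_uniformly_convergent Dm g h)"
      by blast
    from alt show ?L
      unfolding Let_def
    proof (elim disjE exE conjE)
      assume "compactly_divergent M (\<lambda>j. {\<xi>. p j + of_real (\<rho> j) * \<xi> \<in> \<Omega>})
        (\<lambda>j \<xi>. f j (p j + of_real (\<rho> j) * \<xi>))"
      then show ?thesis
        by (rule not_normal_if_compactly_divergent[OF assms(1) p(1) M assms(9) spec[OF f] p(2) \<rho>])
    next
      fix h assume "\<not> h constant_on UNIV"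
        "locally_uniformly_convergent (\<lambda>j. {\<xi>. p j + of_real (\<rho> j) * \<xi> \<in> \<Omega>})
          (\<lambda>j \<xi>. f j (p j + of_real (\<rho> j) * \<xi>)) h"
      then show ?thesis
        by (rule not_normal_if_nonconstant_limit[OF assms(1) p(1) assms(9) spec[OF f] p(2) \<rho>])
    qed
  qed
qed

end
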